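(* Let $G$ be a finite group acting transitively on a finite set $\Omega$, let $\chi_0,\dots,\chi_n$ be the complex irreducible characters of $G$ with $\chi_0$ the trivial character, and let $I$ be the set of all $k\in\{0,\dots,n\}$ such that $\chi_k$ is an irreducible constituent of the permutation character $\xi$ of $G$ on $\Omega$. Let $Y$ be a nonempty subset of $G$ with dual distribution $(a'_0,\dots,a'_n)$. Then $Y$ is transitive on $\Omega$ if and only if $a'_k=0$ for each $k\in I\setminus\{0\}$.
   Context: The permutation character is $\xi(g)=|\{\omega\in\Omega:g\omega=\omega\}|$. A nonempty subset $Y\subseteq G$ is transitive on $\Omega$ if there is a constant $c>0$ such that for all $a,b\in\Omega$ exactly $c$ elements $y\in Y$ satisfy $ya=b$. The dual distribution of $Y$ is $a'_k=\frac{\chi_k(1)}{|Y|}\sum_{x,y\in Y}\chi_k(x^{-1}y)$ for $k=0,\dots,n$. *)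

theory Defs
  imports "HOL-Algebra.Group_Action" "Jordan_Normal_Form.VS_Connect"
begin

section \<open>Complex characters of a group\<close>

definition is_representation ::
  "('g, 'm) monoid_scheme \<Rightarrow> nat \<Rightarrow> ('g \<Rightarrow> complex mat) \<Rightarrow> bool" where
  "is_representation G d \<rho> \<longleftrightarrow>
     (\<forall>g\<in>carrier G. \<rho> g \<in> carrier_mat d d) \<and>
     \<rho> \<one>\<^bsub>G\<^esub> = 1\<^sub>m d \<and>
     (\<forall>g\<in>carrier G. \<forall>h\<in>carrier G. \<rho> (g \<otimes>\<^bsub>G\<^esub> h) = \<rho> g * \<rho> h)"

definition irreducible_representation ::
  "('g, 'm) monoid_scheme \<Rightarrow> nat \<Rightarrow> ('g \<Rightarrow> complex mat) \<Rightarrow> bool" where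
  "irreducible_representation G d \<rho> \<longleftrightarrow>
     is_representation G d \<rho> \<and> d > 0 \<and>
     (\<forall>W. VectorSpace.subspace class_ring W (module_vec TYPE(complex) d) \<longrightarrow>
          (\<forall>g\<in>carrier G. \<forall>w\<in>W. \<rho> g *\<^sub>v w \<in> W) \<longrightarrow>
          W = {0\<^sub>v d} \<or> W = carrier_vec d)"

text \<open>Characters are functions on \<open>carrier G\<close>; being extensional (\<^const>\<open>undefined\<close> elsewhere),
  they are equal as soon as they agree on \<open>carrier G\<close>.\<close>

definition character_of ::
  "('g, 'm) monoid_scheme \<Rightarrow> nat \<Rightarrow> ('g \<Rightarrow> complex mat) \<Rightarrow> 'g \<Rightarrow> complex" where
  "character_of G d \<rho> = (\<lambda>g\<in>carrier G. \<Sum>i<d. \<rho> g $$ (i, i))"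

definition irreducible_characters :: "('g, 'm) monoid_scheme \<Rightarrow> ('g \<Rightarrow> complex) set" where
  "irreducible_characters G =
     {character_of G d \<rho> | d \<rho>. irreducible_representation G d \<rho>}"

text \<open>The irreducible constituents of a character \<open>\<psi>\<close> of a finite group are the irreducible
  characters that occur with positive multiplicity when \<open>\<psi>\<close> is written as a sum of irreducible
  characters. Only the values of \<open>\<psi>\<close> on \<open>carrier G\<close> matter.\<close>

definition irreducible_constituent ::
  "('g, 'm) monoid_scheme \<Rightarrow> ('g \<Rightarrow> complex) \<Rightarrow> ('g \<Rightarrow> complex) \<Rightarrow> bool" where
  "irreducible_constituent G \<psi> \<chi> \<longleftrightarrow>
     \<chi> \<in> irreducible_characters G \<and>
     (\<exists>m :: ('g \<Rightarrow> complex) \<Rightarrow> nat.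
        (\<forall>g\<in>carrier G. \<psi> g = (\<Sum>\<eta>\<in>irreducible_characters G. of_nat (m \<eta>) * \<eta> g)) \<and>
        m \<chi> > 0)"

section \<open>Group actions, transitive subsets and dual distributions\<close>

definition permutation_character ::
  "'w set \<Rightarrow> ('g \<Rightarrow> 'w \<Rightarrow> 'w) \<Rightarrow> 'g \<Rightarrow> complex" where
  "permutation_character \<Omega> \<phi> g = of_nat (card {\<omega>\<in>\<Omega>. \<phi> g \<omega> = \<omega>})"

definition transitive_subset :: "'w set \<Rightarrow> ('g \<Rightarrow> 'w \<Rightarrow> 'w) \<Rightarrow> 'g set \<Rightarrow> bool" where
  "transitive_subset \<Omega> \<phi> Y \<longleftrightarrow>
     (\<exists>c::nat. c > 0 \<and> (\<forall>a\<in>\<Omega>. \<forall>b\<in>\<Omega>. card {y\<in>Y. \<phi> y a = b} = c))"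

definition dual_distribution ::
  "('g, 'm) monoid_scheme \<Rightarrow> (nat \<Rightarrow> 'g \<Rightarrow> complex) \<Rightarrow> 'g set \<Rightarrow> nat \<Rightarrow> complex" where
  "dual_distribution G \<chi> Y k =
     \<chi> k \<one>\<^bsub>G\<^esub> / of_nat (card Y) * (\<Sum>x\<in>Y. \<Sum>y\<in>Y. \<chi> k (inv\<^bsub>G\<^esub> x \<otimes>\<^bsub>G\<^esub> y))"

end

theory Submission
  imports Defs
begin

text \<open>Put \<open>S \<eta> = (\<Sum>x\<in>Y. \<Sum>y\<in>Y. \<eta> (inv x \<otimes> y))\<close>. For the character \<open>\<eta>\<close> of a representation,
  \<open>S \<eta> \<ge> 0\<close>, because \<open>\<eta>\<close> is a positive definite function. For the permutation character, \<open>S \<xi>\<close> is the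
  sum of the squares of the numbers \<open>card {y \<in> Y. \<phi> y a = b}\<close>, and since these numbers have mean
  \<open>card Y / card \<Omega>\<close>, they are all equal if and only if \<open>S \<xi> = (card Y)\<^sup>2\<close>. Write \<open>\<xi> = (\<Sum>\<eta>. m \<eta> * \<eta>)\<close>.
  The trivial character has multiplicity 1 by Burnside's lemma and contributes \<open>(card Y)\<^sup>2\<close> to
  \<open>S \<xi> = (\<Sum>\<eta>. m \<eta> * S \<eta>)\<close>; so \<open>Y\<close> is transitive if and only if the remaining, nonnegative, terms
  vanish.\<close>

section \<open>Decomposition of characters\<close>

text \<open>A basis of \<open>W\<close> is extended to a basis of the whole space. The columns of
  \<open>P\<close> are the basis vectors, those of \<open>W\<close> first, and
  \<open>Q *\<^sub>v v\<close> is the coordinate vector of \<open>v\<close>, so \<open>W\<close> is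
  cut out by the vanishing of the coordinates from \<open>r\<close> on.\<close>

lemma (in vec_space) subspace_coordinates:
  assumes W: "VectorSpace.subspace class_ring W V"
  obtains P Q r where "P \<in> carrier_mat n n" "Q \<in> carrier_mat n n" "P * Q = 1\<^sub>m n" "Q * P = 1\<^sub>m n"
    "r \<le> n" "\<And>v. v \<in> carrier_vec n \<Longrightarrow> v \<in> W \<longleftrightarrow> (\<forall>i. r \<le> i \<longrightarrow> i < n \<longrightarrow> (Q *\<^sub>v v) $ i = 0)"
proof -
  have subm: "submodule class_ring W V"
    using W by simp
  have WV: "W \<subseteq> carrier_vec n"
    using submodule.subset[OF subm] by simp
  have li_bound: "finite S \<and> card S \<le> n" if "S \<subseteq> carrier_vec n \<and> lin_indpt S" for S
    using that li_le_dim[OF fin_dim] dim_is_n by auto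
  have li0: "lin_indpt {}"
    by (rule finite_lin_indpt2) auto
  obtain B where "finite B" and Bmax: "maximal B (\<lambda>S. S \<subseteq> W \<and> lin_indpt S)"
    using maximal_exists[of "\<lambda>S. S \<subseteq> W \<and> lin_indpt S" n "{}"] li_bound WV li0 by blast
  then have B: "B \<subseteq> W" "lin_indpt B"
    by (auto simp: maximal_def)
  have spanB: "span B = W"
  proof
    show "span B \<subseteq> W"
      by (rule span_is_subset[OF B(1) subm])
    show "W \<subseteq> span B"
    proof
      fix w assume w: "w \<in> W"
      show "w \<in> span B"
      proof (cases "w \<in> B")
        case True
        then show ?thesis using B(1) WV in_own_span[of B] by auto
      next
        case False
        have "lin_dep (B \<union> {w})"
          using Bmax False B(1) w unfolding maximal_def by auto
        then show ?thesis
          using lin_dep_iff_in_span[OF _ B(2) _ False] B(1) WV w by auto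
      qed
    qed
  qed
  \<comment> \<open>Maximality is taken among the independent sets containing \<open>B\<close>. A
    larger independent set would again contain \<open>B\<close>, so \<open>C\<close> is maximal
    among all independent sets and hence a basis.\<close>
  obtain C where Cmax: "maximal C (\<lambda>S. B \<subseteq> S \<and> S \<subseteq> carrier_vec n \<and> lin_indpt S)"
    using maximal_exists[of "\<lambda>S. B \<subseteq> S \<and> S \<subseteq> carrier_vec n \<and> lin_indpt S" n B] li_bound WV B by blast
  then have BC: "B \<subseteq> C"
    by (auto simp: maximal_def)
  have "maximal C (\<lambda>S. S \<subseteq> carrier_vec n \<and> lin_indpt S)"
    using Cmax unfolding maximal_def by blast
  then have basis: "basis C"
    by (intro max_li_is_basis) simp
  then have C: "C \<subseteq> carrier_vec n" "span C = carrier_vec n" "finite C" "card C = n"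
    using li_bound[of C] dim_basis[of C] dim_is_n by (auto simp: basis_def)
  obtain bs where bs: "set bs = B" "distinct bs"
    using finite_distinct_list[OF \<open>finite B\<close>] by blast
  obtain cs where cs: "set cs = C - B" "distinct cs"
    using finite_distinct_list[of "C - B"] \<open>finite C\<close> by blast
  define ws where "ws = bs @ cs"
  have ws: "set ws = C" "distinct ws"
    using bs cs BC by (auto simp: ws_def)
  have len: "length ws = n"
    using distinct_card[OF ws(2)] ws(1) C(4) by simp
  define P where "P = mat_of_cols n ws"
  have P: "P \<in> carrier_mat n n"
    using len by (auto simp: P_def)
  have wsn: "\<forall>w\<in>set ws. dim_vec w = n"
    using C(1) ws(1) by auto
  have lc: "lincomb_list c ws = P *\<^sub>v vec n c" for c
    using lincomb_list_as_mat_mult[OF wsn, of c] len by (simp add: P_def)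
  have "\<exists>c. P *\<^sub>v vec n c = v" if "v \<in> carrier_vec n" for v
    using that span_list_as_span[of ws] C ws lc by (metis in_span_listE)
  then obtain c where c: "\<And>v. v \<in> carrier_vec n \<Longrightarrow> P *\<^sub>v vec n (c v) = v"
    by metis
  \<comment> \<open>Column \<open>j\<close> of \<open>Q\<close> lists the coordinates of the
    \<open>j\<close>-th unit vector with respect to \<open>ws\<close>, so \<open>P * Q\<close> is
    the identity column by column.\<close>
  define Q where "Q = mat n n (\<lambda>(i, j). c (unit_vec n j) i)"
  have Q: "Q \<in> carrier_mat n n"
    by (simp add: Q_def)
  have PQ: "P * Q = 1\<^sub>m n"
  proof (rule mat_col_eqI)
    fix j assume "j < dim_col (1\<^sub>m n :: 'a mat)"
    then have j: "j < n" by simp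
    have "col Q j = vec n (c (unit_vec n j))"
      using j by (auto simp: Q_def)
    then show "col (P * Q) j = col (1\<^sub>m n) j"
      using j c[of "unit_vec n j"] by (simp add: col_mult2[OF P Q j] del: col_mult)
  qed (use P Q in auto)
  have QP: "Q * P = 1\<^sub>m n"
    by (rule mat_mult_left_right_inverse[OF P Q PQ])
  define r where "r = length bs"
  have r: "r \<le> n"
    using len by (simp add: r_def ws_def)
  \<comment> \<open>Since \<open>bs\<close> is an initial segment of \<open>ws\<close>, the
    combinations of \<open>bs\<close> are those of \<open>ws\<close> whose coefficients vanish from
    \<open>r\<close> on.\<close>
  have pad: "P *\<^sub>v vec n (\<lambda>i. if i < r then f i else 0) = lincomb_list f bs" for f
  proof -
    have "lincomb_list f bs = mat_of_cols n bs *\<^sub>v vec r f"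
      using lincomb_list_as_mat_mult[of bs f] wsn by (simp add: r_def ws_def)
    also have "\<dots> = P *\<^sub>v vec n (\<lambda>i. if i < r then f i else 0)"
    proof (rule eq_vecI)
      fix i assume "i < dim_vec (P *\<^sub>v vec n (\<lambda>i. if i < r then f i else 0))"
      then have i: "i < n" using P by simp
      have "(P *\<^sub>v vec n (\<lambda>i. if i < r then f i else 0)) $ i
          = (\<Sum>k\<in>{0..<n}. ws ! k $ i * (if k < r then f k else 0))"
        using i P len by (auto simp: scalar_prod_def P_def mat_of_cols_index intro!: sum.cong)
      also have "\<dots> = (\<Sum>k\<in>{0..<r}. ws ! k $ i * (if k < r then f k else 0))"
        using r by (intro sum.mono_neutral_right) auto
      also have "\<dots> = (\<Sum>k\<in>{0..<r}. bs ! k $ i * f k)"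
        by (intro sum.cong) (auto simp: ws_def r_def nth_append)
      also have "\<dots> = (mat_of_cols n bs *\<^sub>v vec r f) $ i"
        using i by (auto simp: scalar_prod_def mat_of_cols_index r_def intro!: sum.cong)
      finally show "(mat_of_cols n bs *\<^sub>v vec r f) $ i = (P *\<^sub>v vec n (\<lambda>i. if i < r then f i else 0)) $ i" ..
    qed (use P in auto)
    finally show ?thesis ..
  qed
  have bsV: "set bs \<subseteq> carrier_vec n"
    using bs B WV by auto
  have Wbs: "W = span_list bs"
    using span_list_as_span[OF bsV] spanB bs by simp
  have "v \<in> W \<longleftrightarrow> (\<forall>i. r \<le> i \<longrightarrow> i < n \<longrightarrow> (Q *\<^sub>v v) $ i = 0)" if v: "v \<in> carrier_vec n" for v
  proof
    assume "v \<in> W"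
    then obtain f where "v = lincomb_list f bs"
      unfolding Wbs by (elim in_span_listE)
    then have vf: "v = P *\<^sub>v vec n (\<lambda>i. if i < r then f i else 0)"
      by (simp add: pad)
    have "Q *\<^sub>v v = (Q * P) *\<^sub>v vec n (\<lambda>i. if i < r then f i else 0)"
      unfolding vf by (rule assoc_mult_mat_vec[symmetric, OF Q P]) simp
    then have "Q *\<^sub>v v = vec n (\<lambda>i. if i < r then f i else 0)"
      by (simp add: QP)
    then show "\<forall>i. r \<le> i \<longrightarrow> i < n \<longrightarrow> (Q *\<^sub>v v) $ i = 0"
      by simp
  next
    assume *: "\<forall>i. r \<le> i \<longrightarrow> i < n \<longrightarrow> (Q *\<^sub>v v) $ i = 0"
    have "v = P *\<^sub>v (Q *\<^sub>v v)"
      using assoc_mult_mat_vec[OF P Q v] PQ v by simp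
    also have "Q *\<^sub>v v = vec n (\<lambda>i. if i < r then (Q *\<^sub>v v) $ i else 0)"
      using Q v * by (intro eq_vecI) auto
    also have "P *\<^sub>v \<dots> = lincomb_list (\<lambda>i. (Q *\<^sub>v v) $ i) bs"
      by (rule pad)
    finally have v_eq: "v = lincomb_list (\<lambda>i. (Q *\<^sub>v v) $ i) bs" .
    show "v \<in> W"
      unfolding Wbs by (rule in_span_listI[OF _ v_eq]) auto
  qed
  then show thesis
    using that P Q PQ QP r by blast
qed

section \<open>Traces, change of basis and block triangular representations\<close>

lemma index_mult_mat_sum:
  assumes "A \<in> carrier_mat l m" "B \<in> carrier_mat m n" "i < l" "j < n"
  shows "(A * B) $$ (i, j) = (\<Sum>k<m. A $$ (i, k) * B $$ (k, j))"
  using assms by (simp add: scalar_prod_def atLeast0LessThan)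

definition trace :: "'a :: comm_monoid_add mat \<Rightarrow> 'a" where
  "trace A = (\<Sum>i<dim_row A. A $$ (i, i))"

lemma trace_carrier: "A \<in> carrier_mat n m \<Longrightarrow> trace A = (\<Sum>i<n. A $$ (i, i))"
  by (simp add: trace_def)

lemma trace_mult_comm:
  fixes A B :: "'a :: comm_semiring_0 mat"
  assumes "A \<in> carrier_mat n m" "B \<in> carrier_mat m n"
  shows "trace (A * B) = trace (B * A)"
proof -
  have "trace (A * B) = (\<Sum>i<n. \<Sum>k<m. A $$ (i, k) * B $$ (k, i))"
    using assms by (simp add: trace_carrier[of _ n n] index_mult_mat_sum[OF assms] del: index_mult_mat)
  also have "\<dots> = (\<Sum>k<m. \<Sum>i<n. B $$ (k, i) * A $$ (i, k))"
    by (subst sum.swap) (simp add: mult.commute)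
  also have "\<dots> = trace (B * A)"
    using assms by (simp add: trace_carrier[of _ m m] index_mult_mat_sum[OF assms(2,1)] del: index_mult_mat)
  finally show ?thesis .
qed

lemma sum_lessThan_add:
  fixes f :: "nat \<Rightarrow> 'a :: comm_monoid_add"
  shows "(\<Sum>k<m + n. f k) = (\<Sum>k<m. f k) + (\<Sum>k<n. f (m + k))"
  by (induction n) (simp_all add: add.assoc)

lemma character_of_eq_trace:
  assumes "is_representation G d \<rho>" "g \<in> carrier G"
  shows "character_of G d \<rho> g = trace (\<rho> g)"
  using assms by (auto simp: character_of_def is_representation_def trace_carrier)

lemma representation_carrier:
  "is_representation G d \<rho> \<Longrightarrow> g \<in> carrier G \<Longrightarrow> \<rho> g \<in> carrier_mat d d"
  by (simp add: is_representation_def)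

lemma representation_mult:
  "is_representation G d \<rho> \<Longrightarrow> g \<in> carrier G \<Longrightarrow> h \<in> carrier G \<Longrightarrow>
    \<rho> (g \<otimes>\<^bsub>G\<^esub> h) = \<rho> g * \<rho> h"
  by (simp add: is_representation_def)

lemma representation_one: "is_representation G d \<rho> \<Longrightarrow> \<rho> \<one>\<^bsub>G\<^esub> = 1\<^sub>m d"
  by (simp add: is_representation_def)

text \<open>The inner factors \<open>P * Q\<close> cancel in a product of two conjugates, and the
  cyclic property of the trace removes the outer ones.\<close>

lemma representation_conjugate:
  assumes \<rho>: "is_representation G d \<rho>"
    and P: "P \<in> carrier_mat d d" and Q: "Q \<in> carrier_mat d d"
    and PQ: "P * Q = 1\<^sub>m d" and QP: "Q * P = 1\<^sub>m d"
  shows "is_representation G d (\<lambda>g. Q * \<rho> g * P)"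
    and "g \<in> carrier G \<Longrightarrow> trace (Q * \<rho> g * P) = trace (\<rho> g)"
proof -
  note assoc = assoc_mult_mat[of _ d d _ d _ d]
  show "is_representation G d (\<lambda>g. Q * \<rho> g * P)"
    unfolding is_representation_def
  proof (intro conjI ballI)
    fix g h assume gh: "g \<in> carrier G" "h \<in> carrier G"
    note c = representation_carrier[OF \<rho> gh(1)] representation_carrier[OF \<rho> gh(2)]
    have "Q * \<rho> g * P * (Q * \<rho> h * P) = Q * \<rho> g * (P * Q) * \<rho> h * P"
      using P Q c by (simp add: assoc)
    then show "Q * \<rho> (g \<otimes>\<^bsub>G\<^esub> h) * P = Q * \<rho> g * P * (Q * \<rho> h * P)"
      using P Q c by (simp add: assoc PQ representation_mult[OF \<rho> gh])
  qed (use P Q QP representation_carrier[OF \<rho>] in \<open>auto simp: representation_one[OF \<rho>]\<close>)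
  assume g: "g \<in> carrier G"
  note c = representation_carrier[OF \<rho> g]
  have "trace (Q * \<rho> g * P) = trace (P * (Q * \<rho> g))"
    using P Q c by (intro trace_mult_comm[of _ d d]) auto
  also have "P * (Q * \<rho> g) = (P * Q) * \<rho> g"
    using P Q c by (simp add: assoc)
  finally show "trace (Q * \<rho> g * P) = trace (\<rho> g)"
    using c by (simp add: PQ)
qed

text \<open>Split at \<open>r\<close>, the sum for an entry of a product has one half with a factor
  in the zero block whenever the entry lies in a diagonal block. The blocks \<open>B\<^sub>1\<close>
  and \<open>B\<^sub>2\<close> are the actions on the invariant subspace and on the quotient by
  it.\<close>

lemma representation_block_triangular:
  assumes B: "is_representation G (r + s) B"
    and zero: "\<And>g i j. g \<in> carrier G \<Longrightarrow> r \<le> i \<Longrightarrow> i < r + s \<Longrightarrow> j < r \<Longrightarrow> B g $$ (i, j) = 0"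
  defines "B\<^sub>1 \<equiv> \<lambda>g. mat r r (\<lambda>(i, j). B g $$ (i, j))"
    and "B\<^sub>2 \<equiv> \<lambda>g. mat s s (\<lambda>(i, j). B g $$ (r + i, r + j))"
  shows "is_representation G r B\<^sub>1" "is_representation G s B\<^sub>2"
    and "g \<in> carrier G \<Longrightarrow> trace (B g) = trace (B\<^sub>1 g) + trace (B\<^sub>2 g)"
proof -
  have prod: "B (g \<otimes>\<^bsub>G\<^esub> h) $$ (i, j) =
      (\<Sum>k<r. B g $$ (i, k) * B h $$ (k, j)) + (\<Sum>k<s. B g $$ (i, r + k) * B h $$ (r + k, j))"
    if "g \<in> carrier G" "h \<in> carrier G" "i < r + s" "j < r + s" for g h i j
    using that by (simp add: representation_mult[OF B] sum_lessThan_add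
        index_mult_mat_sum[OF representation_carrier[OF B] representation_carrier[OF B]] del: index_mult_mat)
  show "is_representation G r B\<^sub>1"
    unfolding is_representation_def
  proof (intro conjI ballI)
    fix g h assume gh: "g \<in> carrier G" "h \<in> carrier G"
    show "B\<^sub>1 (g \<otimes>\<^bsub>G\<^esub> h) = B\<^sub>1 g * B\<^sub>1 h"
    proof (rule eq_matI)
      fix i j assume "i < dim_row (B\<^sub>1 g * B\<^sub>1 h)" "j < dim_col (B\<^sub>1 g * B\<^sub>1 h)"
      then have ij: "i < r" "j < r" by (auto simp: B\<^sub>1_def)
      then show "B\<^sub>1 (g \<otimes>\<^bsub>G\<^esub> h) $$ (i, j) = (B\<^sub>1 g * B\<^sub>1 h) $$ (i, j)"
        using gh by (subst index_mult_mat_sum[of _ r r _ r]) (auto simp: B\<^sub>1_def prod zero)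
    qed (auto simp: B\<^sub>1_def)
  qed (auto simp: B\<^sub>1_def representation_one[OF B])
  show "is_representation G s B\<^sub>2"
    unfolding is_representation_def
  proof (intro conjI ballI)
    fix g h assume gh: "g \<in> carrier G" "h \<in> carrier G"
    show "B\<^sub>2 (g \<otimes>\<^bsub>G\<^esub> h) = B\<^sub>2 g * B\<^sub>2 h"
    proof (rule eq_matI)
      fix i j assume "i < dim_row (B\<^sub>2 g * B\<^sub>2 h)" "j < dim_col (B\<^sub>2 g * B\<^sub>2 h)"
      then have ij: "i < s" "j < s" by (auto simp: B\<^sub>2_def)
      then show "B\<^sub>2 (g \<otimes>\<^bsub>G\<^esub> h) $$ (i, j) = (B\<^sub>2 g * B\<^sub>2 h) $$ (i, j)"
        using gh by (subst index_mult_mat_sum[of _ s s _ s]) (auto simp: B\<^sub>2_def prod zero)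
    qed (auto simp: B\<^sub>2_def)
  qed (auto simp: B\<^sub>2_def representation_one[OF B])
  show "trace (B g) = trace (B\<^sub>1 g) + trace (B\<^sub>2 g)" if "g \<in> carrier G"
    using representation_carrier[OF B that]
    by (simp add: trace_carrier[of _ "r + s" "r + s"] sum_lessThan_add) (simp add: trace_def B\<^sub>1_def B\<^sub>2_def)
qed

text \<open>In coordinates adapted to a proper nonzero invariant subspace the matrices become block
  triangular, and the trace sees only the two diagonal blocks.\<close>

lemma reducible_character_split:
  assumes \<rho>: "is_representation G d \<rho>" and "d > 0"
    and red: "\<not> irreducible_representation G d \<rho>"
  obtains d\<^sub>1 \<rho>\<^sub>1 d\<^sub>2 \<rho>\<^sub>2 where "is_representation G d\<^sub>1 \<rho>\<^sub>1" "is_representation G d\<^sub>2 \<rho>\<^sub>2" "d\<^sub>1 < d" "d\<^sub>2 < d"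
    "\<And>g. g \<in> carrier G \<Longrightarrow>
      character_of G d \<rho> g = character_of G d\<^sub>1 \<rho>\<^sub>1 g + character_of G d\<^sub>2 \<rho>\<^sub>2 g"
proof -
  interpret vec_space "TYPE(complex)" d .
  obtain W where W: "VectorSpace.subspace class_ring W V"
    and inv: "\<And>g w. g \<in> carrier G \<Longrightarrow> w \<in> W \<Longrightarrow> \<rho> g *\<^sub>v w \<in> W"
    and W0: "W \<noteq> {0\<^sub>v d}" "W \<noteq> carrier_vec d"
    using red \<rho> \<open>d > 0\<close> unfolding irreducible_representation_def by auto
  have sub: "submodule class_ring W V"
    using W by simp
  obtain P Q r where P: "P \<in> carrier_mat d d" and Q: "Q \<in> carrier_mat d d"
    and PQ: "P * Q = 1\<^sub>m d" and QP: "Q * P = 1\<^sub>m d" and "r \<le> d"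
    and Wiff: "\<And>v. v \<in> carrier_vec d \<Longrightarrow> v \<in> W \<longleftrightarrow> (\<forall>i. r \<le> i \<longrightarrow> i < d \<longrightarrow> (Q *\<^sub>v v) $ i = 0)"
    using subspace_coordinates[OF W] by blast
  \<comment> \<open>The cases \<open>r = d\<close> and \<open>r = 0\<close> would make
    \<open>W\<close> the whole space or the zero space. Excluding them gives both blocks a degree
    below \<open>d\<close>.\<close>
  have "r \<noteq> d"
    using W0(2) Wiff submodule.subset[OF sub] by auto
  moreover have "r \<noteq> 0"
  proof
    assume "r = 0"
    have "v = 0\<^sub>v d" if "v \<in> W" for v
    proof -
      have v: "v \<in> carrier_vec d"
        using that submodule.subset[OF sub] by auto
      have "Q *\<^sub>v v = 0\<^sub>v d"
        using Wiff[OF v] that \<open>r = 0\<close> Q by (intro eq_vecI) auto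
      then have "P *\<^sub>v (Q *\<^sub>v v) = 0\<^sub>v d"
        using P by auto
      then show ?thesis
        using assoc_mult_mat_vec[OF P Q v] PQ v by simp
    qed
    moreover have "0\<^sub>v d \<in> W"
      using submodule.zero_closed[OF sub] by (simp add: module_vec_simps)
    ultimately show False
      using W0(1) by blast
  qed
  ultimately obtain s where d: "d = r + s" and "0 < r" "0 < s"
    using \<open>r \<le> d\<close> by (metis add.right_neutral bot_nat_0.not_eq_extremum le_Suc_ex)
  define B where "B g = Q * \<rho> g * P" for g
  have B: "is_representation G d B"
    unfolding B_def by (rule representation_conjugate(1)[OF \<rho> P Q PQ QP])
  have tr: "trace (B g) = trace (\<rho> g)" if "g \<in> carrier G" for g
    unfolding B_def by (rule representation_conjugate(2)[OF \<rho> P Q PQ QP that])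
  \<comment> \<open>For \<open>j < r\<close> the column \<open>col P j\<close> is a basis vector of
    \<open>W\<close>. Its image under \<open>\<rho> g\<close> stays in \<open>W\<close>, and the
    coordinates of that image are the entries of column \<open>j\<close> of
    \<open>B g\<close>.\<close>
  have zero: "B g $$ (i, j) = 0" if "g \<in> carrier G" "r \<le> i" "i < d" "j < r" for g i j
  proof -
    have j: "j < d" using that \<open>r \<le> d\<close> by simp
    note c = representation_carrier[OF \<rho> that(1)]
    have cP: "col P j \<in> carrier_vec d"
      using P by (metis carrier_matD(1) col_dim)
    have "Q *\<^sub>v col P j = unit_vec d j"
      using col_mult2[OF Q P j] QP j by (metis col_one)
    then have "col P j \<in> W"
      using Wiff[OF cP] that(4) by simp
    then have "\<rho> g *\<^sub>v col P j \<in> W"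
      using inv that(1) by blast
    then have "(Q *\<^sub>v (\<rho> g *\<^sub>v col P j)) $ i = 0"
      using Wiff[of "\<rho> g *\<^sub>v col P j"] c cP that by auto
    moreover have "Q *\<^sub>v (\<rho> g *\<^sub>v col P j) = col (B g) j"
      unfolding B_def using col_mult2[OF mult_carrier_mat[OF Q c] P j] assoc_mult_mat_vec[OF Q c cP] by simp
    moreover have "B g \<in> carrier_mat d d"
      using representation_carrier[OF B that(1)] .
    ultimately show ?thesis
      using that(3) j by auto
  qed
  define B\<^sub>1 where "B\<^sub>1 g = mat r r (\<lambda>(i, j). B g $$ (i, j))" for g
  define B\<^sub>2 where "B\<^sub>2 g = mat s s (\<lambda>(i, j). B g $$ (r + i, r + j))" for g
  note blocks = representation_block_triangular[OF B[unfolded d] zero[unfolded d], folded B\<^sub>1_def B\<^sub>2_def]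
  have "character_of G d \<rho> g = character_of G r B\<^sub>1 g + character_of G s B\<^sub>2 g" if "g \<in> carrier G" for g
    using blocks(3)[OF _ _ _ _ that] tr[OF that] character_of_eq_trace[OF \<rho> that]
      character_of_eq_trace[OF blocks(1) that] character_of_eq_trace[OF blocks(2) that] by simp
  moreover have "r < d" "s < d"
    using d \<open>0 < r\<close> \<open>0 < s\<close> by auto
  ultimately show thesis
    using that blocks(1,2) by blast
qed

text \<open>Strong induction on the degree: an irreducible representation gets an indicator function
  as multiplicities, and for a reducible one the multiplicities of the two smaller pieces are added.
  Degree 0 is a legitimate start, with the empty trace 0 as its character.\<close>

lemma character_decomposition:
  assumes fin: "finite (irreducible_characters G)"
    and "is_representation G d \<rho>"
  shows "\<exists>m :: ('g \<Rightarrow> complex) \<Rightarrow> nat. \<forall>g\<in>carrier G.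
    character_of G d \<rho> g = (\<Sum>\<eta>\<in>irreducible_characters G. of_nat (m \<eta>) * \<eta> g)"
  using assms(2)
proof (induction d arbitrary: \<rho> rule: less_induct)
  case (less d)
  consider "d = 0" | "irreducible_representation G d \<rho>" | "d > 0" "\<not> irreducible_representation G d \<rho>"
    by blast
  then show ?case
  proof cases
    case 1
    then show ?thesis
      by (intro exI[of _ "\<lambda>_. 0"]) (simp add: character_of_def)
  next
    case 2
    let ?m = "\<lambda>\<eta>. if \<eta> = character_of G d \<rho> then 1 else 0 :: nat"
    have "character_of G d \<rho> \<in> irreducible_characters G"
      using 2 by (auto simp: irreducible_characters_def)
    then have "(\<Sum>\<eta>\<in>irreducible_characters G. of_nat (?m \<eta>) * \<eta> g) = character_of G d \<rho> g" for g
      using fin by (subst sum.remove[of _ "character_of G d \<rho>"]) auto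
    then show ?thesis
      by (intro exI[of _ ?m]) simp
  next
    case 3
    obtain d\<^sub>1 \<rho>\<^sub>1 d\<^sub>2 \<rho>\<^sub>2 where *: "is_representation G d\<^sub>1 \<rho>\<^sub>1" "is_representation G d\<^sub>2 \<rho>\<^sub>2" "d\<^sub>1 < d" "d\<^sub>2 < d"
      "\<And>g. g \<in> carrier G \<Longrightarrow>
        character_of G d \<rho> g = character_of G d\<^sub>1 \<rho>\<^sub>1 g + character_of G d\<^sub>2 \<rho>\<^sub>2 g"
      using reducible_character_split[OF less.prems 3] by blast
    obtain m\<^sub>1 m\<^sub>2 :: "('g \<Rightarrow> complex) \<Rightarrow> nat"
      where "\<And>g. g \<in> carrier G \<Longrightarrow> character_of G d\<^sub>1 \<rho>\<^sub>1 g = (\<Sum>\<eta>\<in>irreducible_characters G. of_nat (m\<^sub>1 \<eta>) * \<eta> g)"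
        "\<And>g. g \<in> carrier G \<Longrightarrow> character_of G d\<^sub>2 \<rho>\<^sub>2 g = (\<Sum>\<eta>\<in>irreducible_characters G. of_nat (m\<^sub>2 \<eta>) * \<eta> g)"
      using less.IH[OF *(3,1)] less.IH[OF *(4,2)] by blast
    then show ?thesis
      using *(5) by (intro exI[of _ "\<lambda>\<eta>. m\<^sub>1 \<eta> + m\<^sub>2 \<eta>"]) (simp add: algebra_simps sum.distrib)
  qed
qed

section \<open>Positive definiteness of characters\<close>

definition adjoint_mat :: "complex mat \<Rightarrow> complex mat" where
  "adjoint_mat A = mat (dim_col A) (dim_row A) (\<lambda>(i, j). cnj (A $$ (j, i)))"

lemma adjoint_mat_carrier [simp]: "A \<in> carrier_mat n m \<Longrightarrow> adjoint_mat A \<in> carrier_mat m n"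
  by (simp add: adjoint_mat_def)

lemma adjoint_mat_index [simp]:
  "A \<in> carrier_mat n m \<Longrightarrow> i < m \<Longrightarrow> j < n \<Longrightarrow> adjoint_mat A $$ (i, j) = cnj (A $$ (j, i))"
  by (auto simp: adjoint_mat_def)

lemma adjoint_mat_adjoint [simp]: "adjoint_mat (adjoint_mat A) = A"
  by (rule eq_matI) (auto simp: adjoint_mat_def)

lemma adjoint_mat_one [simp]: "adjoint_mat (1\<^sub>m n) = 1\<^sub>m n"
  by (rule eq_matI) (auto simp: adjoint_mat_def)

lemma adjoint_mat_mult:
  assumes "A \<in> carrier_mat l m" "B \<in> carrier_mat m n"
  shows "adjoint_mat (A * B) = adjoint_mat B * adjoint_mat A"
proof (rule eq_matI)
  fix i j assume "i < dim_row (adjoint_mat B * adjoint_mat A)" "j < dim_col (adjoint_mat B * adjoint_mat A)"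
  then have ij: "i < n" "j < l"
    using assms by (auto simp: adjoint_mat_def)
  have "adjoint_mat (A * B) $$ (i, j) = cnj ((A * B) $$ (j, i))"
    using assms ij by (intro adjoint_mat_index[of _ l n]) auto
  also have "\<dots> = (\<Sum>k<m. adjoint_mat B $$ (i, k) * adjoint_mat A $$ (k, j))"
    using assms ij by (simp add: index_mult_mat_sum[OF assms ij(2,1)] mult.commute del: index_mult_mat)
  also have "\<dots> = (adjoint_mat B * adjoint_mat A) $$ (i, j)"
    using assms ij by (simp add: index_mult_mat_sum[of _ n m _ l] del: index_mult_mat)
  finally show "adjoint_mat (A * B) $$ (i, j) = (adjoint_mat B * adjoint_mat A) $$ (i, j)" .
qed (use assms in \<open>auto simp: adjoint_mat_def\<close>)

lemma trace_adjoint_mult: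
  assumes "A \<in> carrier_mat n n" "B \<in> carrier_mat n n"
  shows "trace (adjoint_mat A * B) = (\<Sum>i<n. \<Sum>k<n. cnj (A $$ (k, i)) * B $$ (k, i))"
  using index_mult_mat_sum[OF adjoint_mat_carrier[OF assms(1)] assms(2)] adjoint_mat_index[OF assms(1)]
  by (simp add: trace_carrier[OF mult_carrier_mat[OF adjoint_mat_carrier[OF assms(1)] assms(2)]]
      del: index_mult_mat)

section \<open>Sums of families of square matrices\<close>

text \<open>The type of matrices contains all sizes at once and so has no common zero. The size
  \<open>n\<close> is therefore an argument, and the sum is taken entrywise.\<close>

definition mat_family_sum :: "nat \<Rightarrow> ('i \<Rightarrow> 'a :: comm_monoid_add mat) \<Rightarrow> 'i set \<Rightarrow> 'a mat" where
  "mat_family_sum n F S = mat n n (\<lambda>ij. \<Sum>s\<in>S. F s $$ ij)"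

lemma mat_family_sum_carrier [simp]: "mat_family_sum n F S \<in> carrier_mat n n"
  by (simp add: mat_family_sum_def)

lemma mat_family_sum_cong:
  "(\<And>s. s \<in> S \<Longrightarrow> F s = F' s) \<Longrightarrow> mat_family_sum n F S = mat_family_sum n F' S"
  by (simp add: mat_family_sum_def)

lemma mat_family_sum_reindex:
  "bij_betw h S T \<Longrightarrow> mat_family_sum n (\<lambda>s. F (h s)) S = mat_family_sum n F T"
  unfolding mat_family_sum_def by (intro cong_mat refl) (rule sum.reindex_bij_betw)

lemma mult_mat_family_sum:
  fixes A :: "'a :: semiring_0 mat"
  assumes A: "A \<in> carrier_mat n n" and F: "\<And>s. s \<in> S \<Longrightarrow> F s \<in> carrier_mat n n"
  shows "A * mat_family_sum n F S = mat_family_sum n (\<lambda>s. A * F s) S"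
proof (rule eq_matI)
  fix i j assume "i < dim_row (mat_family_sum n (\<lambda>s. A * F s) S)" "j < dim_col (mat_family_sum n (\<lambda>s. A * F s) S)"
  then have ij: "i < n" "j < n"
    by (auto simp: mat_family_sum_def)
  have "(A * mat_family_sum n F S) $$ (i, j) = (\<Sum>k<n. \<Sum>s\<in>S. A $$ (i, k) * F s $$ (k, j))"
    using ij by (subst index_mult_mat_sum[OF A]) (auto simp: mat_family_sum_def sum_distrib_left)
  also have "\<dots> = (\<Sum>s\<in>S. (A * F s) $$ (i, j))"
    using ij by (subst sum.swap) (simp add: index_mult_mat_sum[OF A F] del: index_mult_mat)
  finally show "(A * mat_family_sum n F S) $$ (i, j) = mat_family_sum n (\<lambda>s. A * F s) S $$ (i, j)"
    using ij by (simp add: mat_family_sum_def del: index_mult_mat)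
qed (use A in \<open>auto simp: mat_family_sum_def\<close>)

lemma mat_family_sum_mult:
  fixes A :: "'a :: semiring_0 mat"
  assumes A: "A \<in> carrier_mat n n" and F: "\<And>s. s \<in> S \<Longrightarrow> F s \<in> carrier_mat n n"
  shows "mat_family_sum n F S * A = mat_family_sum n (\<lambda>s. F s * A) S"
proof (rule eq_matI)
  fix i j assume "i < dim_row (mat_family_sum n (\<lambda>s. F s * A) S)" "j < dim_col (mat_family_sum n (\<lambda>s. F s * A) S)"
  then have ij: "i < n" "j < n"
    by (auto simp: mat_family_sum_def)
  have "(mat_family_sum n F S * A) $$ (i, j) = (\<Sum>k<n. \<Sum>s\<in>S. F s $$ (i, k) * A $$ (k, j))"
    using ij by (subst index_mult_mat_sum[OF _ A]) (auto simp: mat_family_sum_def sum_distrib_right)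
  also have "\<dots> = (\<Sum>s\<in>S. (F s * A) $$ (i, j))"
    using ij by (subst sum.swap) (simp add: index_mult_mat_sum[OF F A] del: index_mult_mat)
  finally show "(mat_family_sum n F S * A) $$ (i, j) = mat_family_sum n (\<lambda>s. F s * A) S $$ (i, j)"
    using ij by (simp add: mat_family_sum_def del: index_mult_mat)
qed (use A in \<open>auto simp: mat_family_sum_def\<close>)

lemma trace_mat_family_sum:
  assumes "\<And>s. s \<in> S \<Longrightarrow> F s \<in> carrier_mat n n"
  shows "trace (mat_family_sum n F S) = (\<Sum>s\<in>S. trace (F s))"
proof -
  have "trace (mat_family_sum n F S) = (\<Sum>s\<in>S. \<Sum>i<n. F s $$ (i, i))"
    by (subst sum.swap) (simp add: mat_family_sum_def trace_def)
  then show ?thesis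
    using trace_carrier[OF assms] by simp
qed

section \<open>The invariant Hermitian form and positive definiteness\<close>

text \<open>\<open>H\<close> is the Gram matrix of the standard inner product averaged over the
  group. Right translation by \<open>x\<close> only permutes the summands, which gives invariance.
  The form is positive definite, and from this nonsingularity follows.\<close>

lemma (in group) invariant_form:
  assumes fin: "finite (carrier G)" and \<rho>: "is_representation G d \<rho>"
  defines "H \<equiv> mat_family_sum d (\<lambda>g. adjoint_mat (\<rho> g) * \<rho> g) (carrier G)"
  shows "x \<in> carrier G \<Longrightarrow> adjoint_mat (\<rho> x) * H * \<rho> x = H"
    and "adjoint_mat H = H"
    and "det H \<noteq> 0"
proof -
  note [simp] = representation_carrier[OF \<rho>]
  note assoc = assoc_mult_mat[of _ d d _ d _ d]
  have car [simp]: "A * B \<in> carrier_mat d d" if "A \<in> carrier_mat d d" "B \<in> carrier_mat d d" for A B :: "complex mat"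
    using that by simp
  have adj [simp]: "adjoint_mat A \<in> carrier_mat d d" if "A \<in> carrier_mat d d" for A
    using that by simp
  have H: "H \<in> carrier_mat d d"
    by (simp add: H_def)
  have Hij: "H $$ (i, j) = (\<Sum>g\<in>carrier G. \<Sum>k<d. cnj (\<rho> g $$ (k, i)) * \<rho> g $$ (k, j))"
    if "i < d" "j < d" for i j
    using that unfolding H_def mat_family_sum_def
    by (auto simp: index_mult_mat_sum[of _ d d _ d] adjoint_mat_index[of _ d d] simp del: index_mult_mat intro!: sum.cong)
  show "adjoint_mat (\<rho> x) * H * \<rho> x = H" if x: "x \<in> carrier G"
  proof -
    have "adjoint_mat (\<rho> x) * H * \<rho> x =
        mat_family_sum d (\<lambda>g. adjoint_mat (\<rho> x) * (adjoint_mat (\<rho> g) * \<rho> g) * \<rho> x) (carrier G)"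
      using x unfolding H_def by (simp add: mult_mat_family_sum mat_family_sum_mult)
    also have "\<dots> = mat_family_sum d (\<lambda>g. adjoint_mat (\<rho> (g \<otimes> x)) * \<rho> (g \<otimes> x)) (carrier G)"
      using x by (intro mat_family_sum_cong)
        (simp add: representation_mult[OF \<rho>] adjoint_mat_mult[of _ d d _ d] assoc)
    also have "\<dots> = H"
    proof -
      have "bij_betw (\<lambda>g. g \<otimes> x) (carrier G) (carrier G)"
        using x by (intro bij_betw_byWitness[where f' = "\<lambda>g. g \<otimes> inv x"]) (auto simp: m_assoc)
      then show ?thesis
        unfolding H_def by (rule mat_family_sum_reindex)
    qed
    finally show ?thesis .
  qed
  show "adjoint_mat H = H"
    using carrier_matD[OF H] carrier_matD[OF adjoint_mat_carrier[OF H]] by (intro eq_matI) (auto simp: adjoint_mat_index[OF H] Hij mult.commute intro!: sum.cong)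
  show "det H \<noteq> 0"
  proof
    assume "det H = 0"
    then obtain v where v: "v \<in> carrier_vec d" "v \<noteq> 0\<^sub>v d" "H *\<^sub>v v = 0\<^sub>v d"
      using det_0_iff_vec_prod_zero_field[OF H] by auto
    \<comment> \<open>For a kernel vector \<open>v\<close>, the value of the form at
      \<open>v\<close> is 0. It is also the sum over \<open>g\<close> of the squared norms of
      \<open>\<rho> g *\<^sub>v v\<close>, so each of these vanishes; the one at the identity is the
      squared norm of \<open>v\<close> itself.\<close>
    have "0 = (\<Sum>i<d. cnj (v $ i) * (H *\<^sub>v v) $ i)"
      using v(3) by simp
    also have "\<dots> = (\<Sum>i<d. \<Sum>j<d. \<Sum>g\<in>carrier G. \<Sum>k<d. cnj (\<rho> g $$ (k, i) * v $ i) * (\<rho> g $$ (k, j) * v $ j))"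
      using v(1) H by (auto simp: scalar_prod_def atLeast0LessThan Hij sum_distrib_left sum_distrib_right mult_ac
          intro!: sum.cong)
    also have "\<dots> = (\<Sum>i<d. \<Sum>g\<in>carrier G. \<Sum>k<d. \<Sum>j<d. cnj (\<rho> g $$ (k, i) * v $ i) * (\<rho> g $$ (k, j) * v $ j))"
      by (rule sum.cong[OF refl], subst sum.swap, rule sum.cong[OF refl], rule sum.swap)
    also have "\<dots> = (\<Sum>g\<in>carrier G. \<Sum>k<d. \<Sum>i<d. \<Sum>j<d. cnj (\<rho> g $$ (k, i) * v $ i) * (\<rho> g $$ (k, j) * v $ j))"
      by (subst sum.swap, rule sum.cong[OF refl], rule sum.swap)
    also have "\<dots> = (\<Sum>g\<in>carrier G. \<Sum>k<d. cnj ((\<rho> g *\<^sub>v v) $ k) * (\<rho> g *\<^sub>v v) $ k)"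
    proof (intro sum.cong refl)
      fix g k assume "g \<in> carrier G" "k \<in> {..<d}"
      then have "(\<rho> g *\<^sub>v v) $ k = (\<Sum>i<d. \<rho> g $$ (k, i) * v $ i)"
        using v(1) carrier_matD[OF representation_carrier[OF \<rho>, of g]] by (auto simp: scalar_prod_def atLeast0LessThan)
      then show "(\<Sum>i<d. \<Sum>j<d. cnj (\<rho> g $$ (k, i) * v $ i) * (\<rho> g $$ (k, j) * v $ j)) =
          cnj ((\<rho> g *\<^sub>v v) $ k) * (\<rho> g *\<^sub>v v) $ k"
        by (simp only: cnj_sum sum_product)
    qed
    also have "\<dots> = of_real (\<Sum>g\<in>carrier G. \<Sum>k<d. (cmod ((\<rho> g *\<^sub>v v) $ k))\<^sup>2)"
      by (simp only: of_real_sum complex_norm_square mult.commute)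
    finally have "(\<Sum>g\<in>carrier G. \<Sum>k<d. (cmod ((\<rho> g *\<^sub>v v) $ k))\<^sup>2) = 0"
      by (metis (no_types) of_real_eq_0_iff)
    then have "\<forall>g\<in>carrier G. (\<Sum>k<d. (cmod ((\<rho> g *\<^sub>v v) $ k))\<^sup>2) = 0"
      by (subst (asm) sum_nonneg_eq_0_iff[OF fin]) (intro sum_nonneg zero_le_power2)
    then have "(\<Sum>k<d. (cmod (v $ k))\<^sup>2) = 0"
      using v(1) representation_one[OF \<rho>] one_closed by (metis one_mult_mat_vec)
    then have "\<forall>k<d. v $ k = 0"
      by (subst (asm) sum_nonneg_eq_0_iff) simp_all
    then show False
      using v(1,2) by (metis eq_vecI carrier_vecD index_zero_vec)
  qed
qed

text \<open>The kernel is exhibited as a Gram kernel, from which sums of squares can be read off. In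
  an index \<open>s\<close> the two group elements come from two expansions of the form
  \<open>H\<close>, and the two numbers are a matrix position.\<close>

lemma (in group) character_positive_definite:
  assumes fin: "finite (carrier G)" and \<rho>: "is_representation G d \<rho>"
  obtains S :: "('a \<times> 'a \<times> nat \<times> nat) set" and f where "finite S"
    "\<And>x y. x \<in> carrier G \<Longrightarrow> y \<in> carrier G \<Longrightarrow>
      character_of G d \<rho> (inv x \<otimes> y) = (\<Sum>s\<in>S. cnj (f s x) * f s y)"
proof -
  note [simp] = representation_carrier[OF \<rho>]
  note assoc = assoc_mult_mat[of _ d d _ d _ d]
  have car [simp]: "A * B \<in> carrier_mat d d" if "A \<in> carrier_mat d d" "B \<in> carrier_mat d d" for A B :: "complex mat"
    using that by simp
  have adj [simp]: "adjoint_mat A \<in> carrier_mat d d" if "A \<in> carrier_mat d d" for A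
    using that by simp
  define H where "H = mat_family_sum d (\<lambda>g. adjoint_mat (\<rho> g) * \<rho> g) (carrier G)"
  note form = invariant_form[OF fin \<rho>, folded H_def]
  have H [simp]: "H \<in> carrier_mat d d"
    by (simp add: H_def)
  obtain K where K [simp]: "K \<in> carrier_mat d d" and KH: "K * H = 1\<^sub>m d"
    using det_non_zero_imp_unit[OF H form(3), of "()"] unfolding Units_def ring_mat_def by auto
  have HK: "H * K = 1\<^sub>m d"
    by (rule mat_mult_left_right_inverse[OF K H KH])
  have adjK: "adjoint_mat K = K"
  proof -
    have "adjoint_mat K = adjoint_mat K * (H * K)"
      by (simp add: HK right_mult_one_mat[of _ d d])
    also have "\<dots> = adjoint_mat (H * K) * K"
      by (simp add: adjoint_mat_mult[of _ d d _ d] form(2) assoc)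
    finally show ?thesis
      by (simp add: HK left_mult_one_mat[of _ d d])
  qed
  \<comment> \<open>Multiplying the invariance of \<open>H\<close> under \<open>x\<close> on the
    right by \<open>\<rho> (inv x)\<close> gives
    \<open>adjoint_mat (\<rho> x) * H = H * \<rho> (inv x)\<close>; the inverse \<open>K\<close> of
    \<open>H\<close> then isolates \<open>\<rho> (inv x)\<close>.\<close>
  have inv: "\<rho> (inv x) = K * adjoint_mat (\<rho> x) * H" if x: "x \<in> carrier G" for x
  proof -
    have "\<rho> x * \<rho> (inv x) = 1\<^sub>m d"
      using x representation_mult[OF \<rho>, of x "inv x"] representation_one[OF \<rho>] by simp
    then have "adjoint_mat (\<rho> x) * H = adjoint_mat (\<rho> x) * H * (\<rho> x * \<rho> (inv x))"
      using x by (simp add: right_mult_one_mat[of _ d d])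
    also have "\<dots> = (adjoint_mat (\<rho> x) * H * \<rho> x) * \<rho> (inv x)"
      using x by (simp add: assoc)
    finally have "K * (adjoint_mat (\<rho> x) * H) = K * (H * \<rho> (inv x))"
      using x by (simp add: form(1))
    also have "\<dots> = (K * H) * \<rho> (inv x)"
      using x by (simp add: assoc)
    finally show ?thesis
      using x by (simp add: KH assoc left_mult_one_mat[of _ d d])
  qed
  txt \<open>Writing \<open>H = \<Sum>g. \<rho>(g)\<^sup>* \<rho>(g)\<close> twice inside \<open>\<rho>(x\<inverse>) = K \<rho>(x)\<^sup>* H = K H K \<rho>(x)\<^sup>* H\<close> makes the trace a
    sum of Hermitian squares without taking a square root of \<open>H\<close>.\<close>
  define R where "R g h y = \<rho> h * \<rho> y * K * adjoint_mat (\<rho> g)" for g h y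
  have R: "R g h y \<in> carrier_mat d d" if "g \<in> carrier G" "h \<in> carrier G" "y \<in> carrier G" for g h y
    using that by (simp add: R_def)
  have main: "trace (\<rho> (inv x \<otimes> y)) = (\<Sum>g\<in>carrier G. \<Sum>h\<in>carrier G. trace (adjoint_mat (R g h x) * R g h y))"
    if x: "x \<in> carrier G" and y: "y \<in> carrier G" for x y
  proof -
    have "\<rho> (inv x \<otimes> y) = K * adjoint_mat (\<rho> x) * H * \<rho> y"
      using x y by (simp add: representation_mult[OF \<rho>] inv)
    also have "\<dots> = K * H * K * adjoint_mat (\<rho> x) * H * \<rho> y"
      using x y by (simp add: KH left_mult_one_mat[of _ d d])
    also have "\<dots> = mat_family_sum d (\<lambda>g. mat_family_sum d (\<lambda>h.
        K * (adjoint_mat (\<rho> g) * \<rho> g) * K * adjoint_mat (\<rho> x) * (adjoint_mat (\<rho> h) * \<rho> h) * \<rho> y)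
        (carrier G)) (carrier G)"
    proof -
      have "K * H * K * adjoint_mat (\<rho> x) = mat_family_sum d (\<lambda>g.
        K * (adjoint_mat (\<rho> g) * \<rho> g) * K * adjoint_mat (\<rho> x)) (carrier G)"
        using x unfolding H_def by (simp add: mult_mat_family_sum mat_family_sum_mult)
      then have "K * H * K * adjoint_mat (\<rho> x) * H * \<rho> y = mat_family_sum d (\<lambda>g.
        K * (adjoint_mat (\<rho> g) * \<rho> g) * K * adjoint_mat (\<rho> x) * H * \<rho> y) (carrier G)"
        using x y by (simp add: mult_mat_family_sum mat_family_sum_mult)
      also have "\<dots> = mat_family_sum d (\<lambda>g. mat_family_sum d (\<lambda>h.
        K * (adjoint_mat (\<rho> g) * \<rho> g) * K * adjoint_mat (\<rho> x) * (adjoint_mat (\<rho> h) * \<rho> h) * \<rho> y)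
        (carrier G)) (carrier G)"
        using x y unfolding H_def
        by (intro mat_family_sum_cong) (simp add: mult_mat_family_sum mat_family_sum_mult)
      finally show ?thesis .
    qed
    finally have "trace (\<rho> (inv x \<otimes> y)) = (\<Sum>g\<in>carrier G. \<Sum>h\<in>carrier G. trace (
        K * (adjoint_mat (\<rho> g) * \<rho> g) * K * adjoint_mat (\<rho> x) * (adjoint_mat (\<rho> h) * \<rho> h) * \<rho> y))"
      using x y by (simp add: trace_mat_family_sum)
    also have "\<dots> = (\<Sum>g\<in>carrier G. \<Sum>h\<in>carrier G. trace (adjoint_mat (R g h x) * R g h y))"
    proof (intro sum.cong refl)
      fix g h assume gh: "g \<in> carrier G" "h \<in> carrier G"
      \<comment> \<open>Moving \<open>K * adjoint_mat (\<rho> g)\<close> cyclically to the end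
        leaves \<open>\<rho> g * K * adjoint_mat (\<rho> x) * adjoint_mat (\<rho> h)\<close> in
        front, which is the adjoint of \<open>R g h x\<close> because \<open>K\<close> is
        self-adjoint.\<close>
      let ?M = "\<rho> g * K * adjoint_mat (\<rho> x) * (adjoint_mat (\<rho> h) * \<rho> h) * \<rho> y"
      have "trace (K * (adjoint_mat (\<rho> g) * \<rho> g) * K * adjoint_mat (\<rho> x) * (adjoint_mat (\<rho> h) * \<rho> h) * \<rho> y)
          = trace ((K * adjoint_mat (\<rho> g)) * ?M)"
        using x y gh by (simp add: assoc)
      also have "\<dots> = trace (?M * (K * adjoint_mat (\<rho> g)))"
        using x y gh by (intro trace_mult_comm[of _ d d]) auto
      also have "?M * (K * adjoint_mat (\<rho> g)) = adjoint_mat (R g h x) * R g h y"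
        using x y gh by (simp add: R_def adjoint_mat_mult[of _ d d _ d] adjK assoc)
      finally show "trace (K * (adjoint_mat (\<rho> g) * \<rho> g) * K * adjoint_mat (\<rho> x) *
          (adjoint_mat (\<rho> h) * \<rho> h) * \<rho> y) = trace (adjoint_mat (R g h x) * R g h y)" .
    qed
    finally show ?thesis .
  qed
  show thesis
  proof (rule that)
    show "finite (carrier G \<times> carrier G \<times> {..<d} \<times> {..<d})"
      using fin by simp
    fix x y assume xy: "x \<in> carrier G" "y \<in> carrier G"
    have "character_of G d \<rho> (inv x \<otimes> y) = trace (\<rho> (inv x \<otimes> y))"
      using xy by (intro character_of_eq_trace[OF \<rho>]) simp
    then show "character_of G d \<rho> (inv x \<otimes> y) = (\<Sum>s\<in>carrier G \<times> carrier G \<times> {..<d} \<times> {..<d}.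
        cnj ((\<lambda>(g, h, i, k) y. R g h y $$ (k, i)) s x) * (\<lambda>(g, h, i, k) y. R g h y $$ (k, i)) s y)"
      using xy by (simp add: main trace_adjoint_mult[OF R R] sum.cartesian_product' split_def)
  qed
qed

text \<open>After the sums are interchanged, each index \<open>s\<close> of the Gram kernel
  contributes the squared modulus of the sum of \<open>f s y\<close> over \<open>Y\<close>.\<close>

lemma (in group) sum_character_nonneg:
  assumes fin: "finite (carrier G)" and \<rho>: "is_representation G d \<rho>" and Y: "Y \<subseteq> carrier G"
  obtains r :: real where "r \<ge> 0" "(\<Sum>x\<in>Y. \<Sum>y\<in>Y. character_of G d \<rho> (inv x \<otimes> y)) = of_real r"
proof -
  obtain S :: "('a \<times> 'a \<times> nat \<times> nat) set" and f where S: "finite S"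
    and f: "\<And>x y. x \<in> carrier G \<Longrightarrow> y \<in> carrier G \<Longrightarrow>
      character_of G d \<rho> (inv x \<otimes> y) = (\<Sum>s\<in>S. cnj (f s x) * f s y)"
    using character_positive_definite[OF fin \<rho>] by blast
  have "(\<Sum>x\<in>Y. \<Sum>y\<in>Y. character_of G d \<rho> (inv x \<otimes> y)) = (\<Sum>x\<in>Y. \<Sum>y\<in>Y. \<Sum>s\<in>S. cnj (f s x) * f s y)"
    using Y by (intro sum.cong refl f) auto
  also have "\<dots> = (\<Sum>x\<in>Y. \<Sum>s\<in>S. \<Sum>y\<in>Y. cnj (f s x) * f s y)"
    by (intro sum.cong refl, rule sum.swap)
  also have "\<dots> = (\<Sum>s\<in>S. \<Sum>x\<in>Y. \<Sum>y\<in>Y. cnj (f s x) * f s y)"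
    by (rule sum.swap)
  also have "\<dots> = (\<Sum>s\<in>S. cnj (\<Sum>x\<in>Y. f s x) * (\<Sum>y\<in>Y. f s y))"
    by (simp only: cnj_sum sum_product)
  also have "\<dots> = of_real (\<Sum>s\<in>S. (cmod (\<Sum>y\<in>Y. f s y))\<^sup>2)"
    by (simp only: of_real_sum complex_norm_square mult.commute)
  finally show thesis
    using that by (metis (no_types, lifting) sum_nonneg zero_le_power2)
qed

section \<open>Sums of irreducible characters\<close>

lemma subspace_vecI:
  fixes W :: "'a :: field vec set"
  assumes "W \<subseteq> carrier_vec n" "0\<^sub>v n \<in> W" "\<And>v w. v \<in> W \<Longrightarrow> w \<in> W \<Longrightarrow> v + w \<in> W"
    "\<And>c v. v \<in> W \<Longrightarrow> c \<cdot>\<^sub>v v \<in> W"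
  shows "VectorSpace.subspace class_ring W (module_vec TYPE('a) n)"
  using assms by (auto simp: VectorSpace.subspace_def submodule_def vec_vs vec_module module_vec_simps)

text \<open>Under the trivial action every subspace is invariant. In dimension above 1 the line
  through the first unit vector is a proper nonzero one.\<close>

lemma irreducible_fixed_imp_dim_1:
  assumes irr: "irreducible_representation G d \<rho>"
    and fixed: "\<And>g v. g \<in> carrier G \<Longrightarrow> v \<in> carrier_vec d \<Longrightarrow> \<rho> g *\<^sub>v v = v"
  shows "d = 1"
proof (rule ccontr)
  assume "d \<noteq> 1"
  then have d: "d > 1"
    using irr unfolding irreducible_representation_def by linarith
  define W :: "complex vec set" where "W = {v \<in> carrier_vec d. \<forall>i. 0 < i \<longrightarrow> i < d \<longrightarrow> v $ i = 0}"
  have "VectorSpace.subspace class_ring W (module_vec TYPE(complex) d)"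
    by (rule subspace_vecI) (auto simp: W_def)
  moreover have "\<forall>g\<in>carrier G. \<forall>w\<in>W. \<rho> g *\<^sub>v w \<in> W"
    using fixed by (auto simp: W_def)
  ultimately have "W = {0\<^sub>v d} \<or> W = carrier_vec d"
    using irr unfolding irreducible_representation_def by blast
  moreover have "unit_vec d 0 \<in> W" "unit_vec d 0 \<noteq> (0\<^sub>v d :: complex vec)"
    using d by (auto simp: W_def dest!: arg_cong[of _ _ "\<lambda>v. v $ 0"])
  moreover have "unit_vec d 1 \<notin> W"
    using d by (auto simp: W_def intro!: exI[of _ 1])
  ultimately show False
    by auto
qed

text \<open>The sum \<open>N\<close> of all \<open>\<rho> g\<close> absorbs each
  \<open>\<rho> g\<close> from the left, so its image is an invariant subspace on which the group
  acts trivially. The trace of \<open>N\<close> is the given nonzero sum, hence the image is not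
  zero and, by irreducibility, is everything. The action is then trivial and of degree 1.\<close>

lemma (in group) sum_irreducible_character:
  assumes irr: "irreducible_representation G d \<rho>"
    and nz: "(\<Sum>g\<in>carrier G. character_of G d \<rho> g) \<noteq> 0" and x: "x \<in> carrier G"
  shows "character_of G d \<rho> x = 1"
proof -
  have \<rho>: "is_representation G d \<rho>"
    using irr by (simp add: irreducible_representation_def)
  note [simp] = representation_carrier[OF \<rho>]
  define N where "N = mat_family_sum d \<rho> (carrier G)"
  have N: "N \<in> carrier_mat d d"
    by (simp add: N_def)
  have inv: "\<rho> g * N = N" if g: "g \<in> carrier G" for g
  proof -
    have "\<rho> g * N = mat_family_sum d (\<lambda>h. \<rho> (g \<otimes> h)) (carrier G)"
      using g unfolding N_def
      by (subst mult_mat_family_sum) (auto intro!: mat_family_sum_cong simp: representation_mult[OF \<rho>])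
    moreover have "bij_betw (\<lambda>h. g \<otimes> h) (carrier G) (carrier G)"
      using g by (intro bij_betw_byWitness[where f' = "\<lambda>h. inv g \<otimes> h"]) (auto simp flip: m_assoc)
    ultimately show ?thesis
      unfolding N_def using mat_family_sum_reindex by metis
  qed
  define W where "W = (\<lambda>v. N *\<^sub>v v) ` carrier_vec d"
  have "VectorSpace.subspace class_ring W (module_vec TYPE(complex) d)"
  proof (rule subspace_vecI)
    show "W \<subseteq> carrier_vec d"
      using N by (auto simp: W_def)
    show "0\<^sub>v d \<in> W"
      using N unfolding W_def by (intro image_eqI[of _ _ "0\<^sub>v d"]) auto
    show "v + w \<in> W" if "v \<in> W" "w \<in> W" for v w
      using that unfolding W_def by (auto simp flip: mult_add_distrib_mat_vec[OF N])
    show "c \<cdot>\<^sub>v v \<in> W" if "v \<in> W" for c v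
      using that unfolding W_def by (auto simp flip: mult_mat_vec[OF N])
  qed
  moreover have fixed: "\<rho> g *\<^sub>v w = w" if "g \<in> carrier G" "w \<in> W" for g w
    using that N by (auto simp: W_def inv simp flip: assoc_mult_mat_vec[of _ d d _ d])
  ultimately have "W = {0\<^sub>v d} \<or> W = carrier_vec d"
    using irr unfolding irreducible_representation_def by simp
  moreover have "W \<noteq> {0\<^sub>v d}"
  proof
    assume W: "W = {0\<^sub>v d}"
    have "N $$ (i, i) = 0" if "i < d" for i
    proof -
      have "col N i = N *\<^sub>v unit_vec d i"
        using N that by (metis col_mult2 col_one one_carrier_mat right_mult_one_mat)
      then have "col N i = 0\<^sub>v d"
        using W unfolding W_def by auto
      then show ?thesis
        using N that by (metis carrier_matD index_col index_zero_vec(1))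
    qed
    then have "trace N = 0"
      using N by (simp add: trace_carrier)
    moreover have "trace N = (\<Sum>g\<in>carrier G. character_of G d \<rho> g)"
      unfolding N_def by (simp add: trace_mat_family_sum character_of_eq_trace[OF \<rho>])
    ultimately show False
      using nz by simp
  qed
  ultimately have W: "W = carrier_vec d"
    by blast
  have d: "d = 1"
    using irreducible_fixed_imp_dim_1[OF irr] fixed W by auto
  have "\<rho> x *\<^sub>v unit_vec 1 0 = unit_vec 1 0"
    using fixed x W d by simp
  then have "(\<rho> x *\<^sub>v unit_vec 1 0) $ 0 = 1"
    by simp
  then have "\<rho> x $$ (0, 0) = 1"
    using representation_carrier[OF \<rho> x] d by (simp add: scalar_prod_def)
  then show ?thesis
    using x d by (simp add: character_of_def)
qed

section \<open>Permutation characters and transitive subsets\<close>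

lemma card_filter_eq_sum:
  "finite A \<Longrightarrow> of_nat (card {a \<in> A. P a}) = (\<Sum>a\<in>A. if P a then 1 else 0 :: 'b :: semiring_1)"
  by (simp add: sum.If_cases Int_def)

text \<open>The permutation matrices afford this character: a diagonal entry is 1 exactly at a fixed
  point. The bijection \<open>e\<close> numbers the points, since matrices are indexed by
  naturals.\<close>

lemma (in group_action) permutation_character_afforded:
  assumes fin: "finite E"
  obtains d \<rho> where "is_representation G d \<rho>"
    "\<And>g. g \<in> carrier G \<Longrightarrow> character_of G d \<rho> g = permutation_character E \<phi> g"
proof -
  define N where "N = card E"
  obtain e where e: "bij_betw e {..<N} E"
    using ex_bij_betw_nat_finite[OF fin] by (auto simp: N_def atLeast0LessThan)
  have eE: "e i \<in> E" if "i < N" for i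
    using e that by (auto simp: bij_betw_def)
  have e_inj: "e i = e j \<longleftrightarrow> i = j" if "i < N" "j < N" for i j
    using e that by (auto simp: bij_betw_def inj_on_def)
  have one: "\<phi> \<one> x = x" if "x \<in> E" for x
    using id_eq_one that by (metis restrict_apply')
  \<comment> \<open>Column \<open>j\<close> has its single 1 in the row of the image of
    \<open>e j\<close>. With this orientation a left action yields a homomorphism.\<close>
  define \<rho> where "\<rho> g = mat N N (\<lambda>(i, j). if \<phi> g (e j) = e i then 1 else 0 :: complex)" for g
  have "is_representation G N \<rho>"
    unfolding is_representation_def
  proof (intro conjI ballI)
    show "\<rho> \<one> = 1\<^sub>m N"
      by (rule eq_matI) (auto simp: \<rho>_def one eE e_inj)
    fix g h assume gh: "g \<in> carrier G" "h \<in> carrier G"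
    show "\<rho> (g \<otimes> h) = \<rho> g * \<rho> h"
    proof (rule eq_matI)
      fix i j assume "i < dim_row (\<rho> g * \<rho> h)" "j < dim_col (\<rho> g * \<rho> h)"
      then have ij: "i < N" "j < N" by (auto simp: \<rho>_def)
      have "\<phi> h (e j) \<in> E"
        using element_image[OF gh(2) eE[OF ij(2)]] by blast
      then obtain k where k: "k < N" "\<phi> h (e j) = e k"
        using e by (auto simp: bij_betw_def)
      have "(\<rho> g * \<rho> h) $$ (i, j) = (\<Sum>l<N. \<rho> g $$ (i, l) * \<rho> h $$ (l, j))"
        using ij by (intro index_mult_mat_sum[of _ N N _ N]) (auto simp: \<rho>_def)
      also have "\<dots> = (\<Sum>l<N. if l = k then \<rho> g $$ (i, k) else 0)"
        using ij k by (intro sum.cong) (auto simp: \<rho>_def e_inj)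
      also have "\<dots> = \<rho> (g \<otimes> h) $$ (i, j)"
        using ij k composition_rule[OF eE[OF ij(2)] gh] by (simp add: \<rho>_def)
      finally show "\<rho> (g \<otimes> h) $$ (i, j) = (\<rho> g * \<rho> h) $$ (i, j)" ..
    qed (auto simp: \<rho>_def)
  qed (auto simp: \<rho>_def)
  moreover have "character_of G N \<rho> g = permutation_character E \<phi> g" if g: "g \<in> carrier G" for g
  proof -
    have "character_of G N \<rho> g = (\<Sum>i<N. if \<phi> g (e i) = e i then 1 else 0)"
      using g by (simp add: character_of_def \<rho>_def)
    also have "\<dots> = (\<Sum>a\<in>E. if \<phi> g a = a then 1 else 0)"
      by (rule sum.reindex_bij_betw[OF e])
    finally show ?thesis
      using fin by (simp only: permutation_character_def card_filter_eq_sum)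
  qed
  ultimately show thesis
    using that by blast
qed

text \<open>A point \<open>a\<close> is fixed by \<open>inv x \<otimes> y\<close> exactly when
  \<open>x\<close> and \<open>y\<close> send \<open>a\<close> to the same point. Both sides count
  the triples of \<open>x\<close>, \<open>y\<close>, \<open>a\<close> with this property; on the
  right they are sorted by \<open>a\<close> and the common image \<open>b\<close>.\<close>

lemma (in group_action) sum_permutation_character:
  assumes fin: "finite E" and Y: "Y \<subseteq> carrier G" "finite Y"
  shows "(\<Sum>x\<in>Y. \<Sum>y\<in>Y. permutation_character E \<phi> (inv x \<otimes> y)) =
    of_nat (\<Sum>a\<in>E. \<Sum>b\<in>E. (card {y\<in>Y. \<phi> y a = b})\<^sup>2)"
proof -
  interpret group G
    using group_hom group_hom.axioms(1) by auto
  have fixed: "\<phi> (inv x \<otimes> y) a = a \<longleftrightarrow> \<phi> y a = \<phi> x a"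
    if "x \<in> Y" "y \<in> Y" "a \<in> E" for x y a
  proof -
    have xy: "x \<in> carrier G" "y \<in> carrier G" using that Y by auto
    then have "\<phi> (inv x \<otimes> y) a = \<phi> (inv x) (\<phi> y a)"
      using that by (simp add: composition_rule)
    moreover have "\<phi> (inv x) (\<phi> x a) = a"
      using orbit_sym_aux[OF xy(1) that(3)] by simp
    moreover have "\<phi> y a \<in> E" "\<phi> x a \<in> E"
      using element_image xy that(3) by blast+
    moreover have "inj_on (\<phi> (inv x)) E"
      using inj_prop xy by simp
    ultimately show ?thesis
      by (metis inj_onD)
  qed
  have pairs: "(\<Sum>x\<in>Y. \<Sum>y\<in>Y. if \<phi> y a = \<phi> x a then 1 else 0) =
      (\<Sum>b\<in>E. of_nat (card {y\<in>Y. \<phi> y a = b}) ^ 2 :: complex)" if a: "a \<in> E" for a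
  proof -
    have "(\<Sum>x\<in>Y. \<Sum>y\<in>Y. if \<phi> y a = \<phi> x a then 1 else 0 :: complex) =
        (\<Sum>x\<in>Y. \<Sum>y\<in>Y. \<Sum>b\<in>E. (if \<phi> x a = b then 1 else 0) * (if \<phi> y a = b then 1 else 0))"
    proof (intro sum.cong refl)
      fix x y assume "x \<in> Y" "y \<in> Y"
      have "\<phi> x a \<in> E"
        using element_image Y \<open>x \<in> Y\<close> a by blast
      moreover have "(\<Sum>b\<in>E. (if \<phi> x a = b then 1 else 0) * (if \<phi> y a = b then 1 else 0 :: complex)) =
          (\<Sum>b\<in>E. if \<phi> x a = b then if \<phi> y a = b then 1 else 0 else 0)"
        by (intro sum.cong) auto
      ultimately show "(if \<phi> y a = \<phi> x a then 1 else 0 :: complex) =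
          (\<Sum>b\<in>E. (if \<phi> x a = b then 1 else 0) * (if \<phi> y a = b then 1 else 0))"
        using fin by simp
    qed
    also have "\<dots> = (\<Sum>x\<in>Y. \<Sum>b\<in>E. \<Sum>y\<in>Y. (if \<phi> x a = b then 1 else 0) * (if \<phi> y a = b then 1 else 0))"
      by (rule sum.cong[OF refl], rule sum.swap)
    also have "\<dots> = (\<Sum>b\<in>E. \<Sum>x\<in>Y. \<Sum>y\<in>Y. (if \<phi> x a = b then 1 else 0) * (if \<phi> y a = b then 1 else 0))"
      by (rule sum.swap)
    finally show ?thesis
      by (simp only: card_filter_eq_sum[OF Y(2)] power2_eq_square sum_product)
  qed
  have "(\<Sum>x\<in>Y. \<Sum>y\<in>Y. permutation_character E \<phi> (inv x \<otimes> y)) =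
      (\<Sum>x\<in>Y. \<Sum>y\<in>Y. \<Sum>a\<in>E. if \<phi> y a = \<phi> x a then 1 else 0)"
    unfolding permutation_character_def card_filter_eq_sum[OF fin] by (intro sum.cong refl) (simp add: fixed)
  also have "\<dots> = (\<Sum>x\<in>Y. \<Sum>a\<in>E. \<Sum>y\<in>Y. if \<phi> y a = \<phi> x a then 1 else 0)"
    by (rule sum.cong[OF refl], rule sum.swap)
  also have "\<dots> = (\<Sum>a\<in>E. \<Sum>x\<in>Y. \<Sum>y\<in>Y. if \<phi> y a = \<phi> x a then 1 else 0)"
    by (rule sum.swap)
  finally show ?thesis
    by (simp add: pairs)
qed

text \<open>This is Burnside's lemma with exactly one orbit; an empty \<open>E\<close> would have
  none.\<close>

lemma (in transitive_action) sum_carrier_permutation_character: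
  assumes "finite (carrier G)" "finite E" "E \<noteq> {}"
  shows "(\<Sum>g\<in>carrier G. permutation_character E \<phi> g) = of_nat (card (carrier G))"
proof -
  have "orbit G \<phi> x = E" if "x \<in> E" for x
    using unique_orbit[OF that] element_image that by (auto simp: orbit_def)
  then have "orbits G E \<phi> = {E}"
    using assms(3) by (auto simp: orbits_def)
  then show ?thesis
    using burnside[OF assms(1,2)]
    by (simp add: permutation_character_def invariants_def Coset.order_def flip: of_nat_sum)
qed

text \<open>The variance of the matrix \<open>(card {y \<in> Y. \<phi> y a = b})\<^sub>a\<^sub>b\<close> vanishes precisely when its entries
  are all equal.\<close>

lemma (in group_action) transitive_subset_iff:
  assumes fin: "finite E" "E \<noteq> {}" and Y: "Y \<subseteq> carrier G" "finite Y" "Y \<noteq> {}"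
  shows "transitive_subset E \<phi> Y \<longleftrightarrow>
    (\<Sum>a\<in>E. \<Sum>b\<in>E. (card {y\<in>Y. \<phi> y a = b})\<^sup>2) = (card Y)\<^sup>2"
proof -
  define T where "T a b = card {y\<in>Y. \<phi> y a = b}" for a b
  define n where "n = card E"
  have n: "n > 0"
    using fin by (auto simp: n_def card_gt_0_iff)
  have Y0: "card Y > 0"
    using Y by (auto simp: card_gt_0_iff)
  \<comment> \<open>Each element of \<open>Y\<close> sends \<open>a\<close> to exactly one point of
    \<open>E\<close>.\<close>
  have row: "(\<Sum>b\<in>E. T a b) = card Y" if a: "a \<in> E" for a
  proof -
    have "(\<lambda>y. \<phi> y a) ` Y \<subseteq> E"
      using element_image Y(1) a by blast
    then show ?thesis
      using sum.group[OF Y(2) fin(1), of "\<lambda>y. \<phi> y a" "\<lambda>_. 1 :: nat"] by (simp add: T_def)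
  qed
  \<comment> \<open>The deviations from the mean \<open>card Y / n\<close> are scaled by
    \<open>n\<close> to avoid fractions. By \<open>row\<close> the cross term is minus twice the
    constant term, so a single negative term survives.\<close>
  have "(\<Sum>a\<in>E. \<Sum>b\<in>E. (real n * real (T a b) - real (card Y))\<^sup>2) =
      (\<Sum>a\<in>E. (real n)\<^sup>2 * (\<Sum>b\<in>E. (real (T a b))\<^sup>2) - real n * (real (card Y))\<^sup>2)"
  proof (rule sum.cong[OF refl])
    fix a assume a: "a \<in> E"
    have row': "(\<Sum>b\<in>E. real (T a b)) = real (card Y)"
      using row[OF a] by (metis of_nat_sum)
    have "(\<Sum>b\<in>E. (real n * real (T a b) - real (card Y))\<^sup>2) =
        (\<Sum>b\<in>E. (real n)\<^sup>2 * (real (T a b))\<^sup>2 - 2 * real n * real (card Y) * real (T a b) + (real (card Y))\<^sup>2)"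
      by (intro sum.cong) (auto simp: power2_eq_square algebra_simps)
    also have "\<dots> = (real n)\<^sup>2 * (\<Sum>b\<in>E. (real (T a b))\<^sup>2) - 2 * real n * real (card Y) * (\<Sum>b\<in>E. real (T a b))
        + real n * (real (card Y))\<^sup>2"
      by (simp add: sum.distrib sum_subtractf n_def flip: sum_distrib_left)
    finally show "(\<Sum>b\<in>E. (real n * real (T a b) - real (card Y))\<^sup>2) =
        (real n)\<^sup>2 * (\<Sum>b\<in>E. (real (T a b))\<^sup>2) - real n * (real (card Y))\<^sup>2"
      by (simp add: row' power2_eq_square)
  qed
  also have "\<dots> = (real n)\<^sup>2 * (real (\<Sum>a\<in>E. \<Sum>b\<in>E. (T a b)\<^sup>2) - (real (card Y))\<^sup>2)"
    by (simp add: sum_subtractf n_def power2_eq_square right_diff_distrib flip: sum_distrib_left)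
  finally have "(\<Sum>a\<in>E. \<Sum>b\<in>E. (T a b)\<^sup>2) = (card Y)\<^sup>2 \<longleftrightarrow>
      (\<Sum>a\<in>E. \<Sum>b\<in>E. (real n * real (T a b) - real (card Y))\<^sup>2) = 0"
    using n by (simp flip: of_nat_power of_nat_sum)
  also have "\<dots> \<longleftrightarrow> (\<forall>a\<in>E. \<forall>b\<in>E. n * T a b = card Y)"
    using fin by (simp add: sum_nonneg_eq_0_iff sum_nonneg flip: of_nat_mult)
  also have "\<dots> \<longleftrightarrow> transitive_subset E \<phi> Y"
  proof
    assume *: "\<forall>a\<in>E. \<forall>b\<in>E. n * T a b = card Y"
    have "T a b = card Y div n" if "a \<in> E" "b \<in> E" for a b
      using * that n by (metis nonzero_mult_div_cancel_left less_not_refl2)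
    moreover obtain a where "a \<in> E"
      using fin by auto
    \<comment> \<open>Any entry would do to show that the common value is positive, as
      \<open>transitive_subset\<close> demands.\<close>
    moreover have "T a a > 0"
      using * \<open>a \<in> E\<close> Y0 by (metis mult_0_right neq0_conv)
    ultimately show "transitive_subset E \<phi> Y"
      unfolding transitive_subset_def T_def by metis
  next
    assume "transitive_subset E \<phi> Y"
    then obtain c where "\<And>a b. a \<in> E \<Longrightarrow> b \<in> E \<Longrightarrow> T a b = c"
      by (auto simp: transitive_subset_def T_def)
    then show "\<forall>a\<in>E. \<forall>b\<in>E. n * T a b = card Y"
      using row by (simp add: n_def)
  qed
  finally show ?thesis
    unfolding T_def by blast
qed

section \<open>Multiplicities and the criterion in terms of characters\<close>

text \<open>The value at the identity is the degree. It appears as a factor in the dual distribution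
  and can thus be cancelled.\<close>

lemma (in group) irreducible_character_one:
  assumes "\<eta> \<in> irreducible_characters G"
  shows "\<eta> \<one> \<noteq> 0"
  using assms
  by (auto simp: irreducible_characters_def character_of_def irreducible_representation_def representation_one)

text \<open>Summed over the group, every irreducible character except \<open>\<chi>\<^sub>0\<close>
  gives 0, so comparison with Burnside's lemma forces \<open>m \<chi>\<^sub>0 = 1\<close>. This
  holds for every multiplicity function \<open>m\<close> that represents the permutation
  character.\<close>

lemma (in transitive_action) sum_permutation_character_decomposition:
  assumes fin: "finite (carrier G)" "finite E" and Y: "Y \<subseteq> carrier G"
    and irr: "finite (irreducible_characters G)"
    and \<chi>\<^sub>0: "\<chi>\<^sub>0 \<in> irreducible_characters G" "\<And>g. g \<in> carrier G \<Longrightarrow> \<chi>\<^sub>0 g = 1"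
    and m: "\<And>g. g \<in> carrier G \<Longrightarrow>
      permutation_character E \<phi> g = (\<Sum>\<eta>\<in>irreducible_characters G. of_nat (m \<eta>) * \<eta> g)"
    and E: "E \<noteq> {}"
  shows "(\<Sum>x\<in>Y. \<Sum>y\<in>Y. permutation_character E \<phi> (inv x \<otimes> y)) = of_nat ((card Y)\<^sup>2) +
    (\<Sum>\<eta>\<in>irreducible_characters G - {\<chi>\<^sub>0}. of_nat (m \<eta>) * (\<Sum>x\<in>Y. \<Sum>y\<in>Y. \<eta> (inv x \<otimes> y)))"
proof -
  interpret group G
    using group_hom group_hom.axioms(1) by auto
  have nontriv: "(\<Sum>g\<in>carrier G. \<eta> g) = 0" if \<eta>: "\<eta> \<in> irreducible_characters G - {\<chi>\<^sub>0}" for \<eta>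
  proof (rule ccontr)
    assume nz: "(\<Sum>g\<in>carrier G. \<eta> g) \<noteq> 0"
    obtain d \<rho> where \<rho>: "irreducible_representation G d \<rho>" "\<eta> = character_of G d \<rho>"
      using \<eta> by (auto simp: irreducible_characters_def)
    obtain d\<^sub>0 \<rho>\<^sub>0 where \<rho>\<^sub>0: "\<chi>\<^sub>0 = character_of G d\<^sub>0 \<rho>\<^sub>0"
      using \<chi>\<^sub>0(1) by (auto simp: irreducible_characters_def)
    \<comment> \<open>Both characters are constantly 1 on the group and \<open>undefined\<close>
      outside it, so they agree as functions.\<close>
    have "\<eta> g = \<chi>\<^sub>0 g" if "g \<in> carrier G" for g
      using sum_irreducible_character[OF \<rho>(1) _ that] nz \<rho>(2) \<chi>\<^sub>0(2)[OF that] by simp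
    then have "\<eta> = \<chi>\<^sub>0"
      unfolding \<rho>(2) \<rho>\<^sub>0 character_of_def by (intro ext) (auto simp: restrict_def split: if_splits)
    then show False
      using \<eta> by simp
  qed
  have "of_nat (card (carrier G)) = (\<Sum>g\<in>carrier G. permutation_character E \<phi> g)"
    using sum_carrier_permutation_character[OF fin E] ..
  also have "\<dots> = (\<Sum>g\<in>carrier G. \<Sum>\<eta>\<in>irreducible_characters G. of_nat (m \<eta>) * \<eta> g)"
    by (intro sum.cong refl m)
  also have "\<dots> = (\<Sum>\<eta>\<in>irreducible_characters G. of_nat (m \<eta>) * (\<Sum>g\<in>carrier G. \<eta> g))"
    by (subst sum.swap) (simp add: sum_distrib_left)
  also have "\<dots> = of_nat (m \<chi>\<^sub>0) * (\<Sum>g\<in>carrier G. \<chi>\<^sub>0 g)"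
    by (subst sum.remove[OF irr \<chi>\<^sub>0(1)]) (simp add: nontriv)
  also have "\<dots> = of_nat (m \<chi>\<^sub>0) * of_nat (card (carrier G))"
    by (simp add: \<chi>\<^sub>0(2))
  finally have "of_nat (card (carrier G)) * (of_nat (m \<chi>\<^sub>0) - 1) = (0 :: complex)"
    by (simp add: algebra_simps)
  moreover have "card (carrier G) \<noteq> 0"
    using fin one_closed by auto
  ultimately have m0: "of_nat (m \<chi>\<^sub>0) = (1 :: complex)"
    by simp
  have triv: "(\<Sum>x\<in>Y. \<Sum>y\<in>Y. \<chi>\<^sub>0 (inv x \<otimes> y)) = of_nat ((card Y)\<^sup>2)"
  proof -
    have "(\<Sum>x\<in>Y. \<Sum>y\<in>Y. \<chi>\<^sub>0 (inv x \<otimes> y)) = (\<Sum>x\<in>Y. \<Sum>y\<in>Y. 1)"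
      using Y by (intro sum.cong refl \<chi>\<^sub>0(2)) auto
    then show ?thesis
      by (simp add: power2_eq_square)
  qed
  have "(\<Sum>x\<in>Y. \<Sum>y\<in>Y. permutation_character E \<phi> (inv x \<otimes> y)) =
      (\<Sum>x\<in>Y. \<Sum>y\<in>Y. \<Sum>\<eta>\<in>irreducible_characters G. of_nat (m \<eta>) * \<eta> (inv x \<otimes> y))"
    using Y by (intro sum.cong refl m) auto
  also have "\<dots> = (\<Sum>x\<in>Y. \<Sum>\<eta>\<in>irreducible_characters G. \<Sum>y\<in>Y. of_nat (m \<eta>) * \<eta> (inv x \<otimes> y))"
    by (rule sum.cong[OF refl], rule sum.swap)
  also have "\<dots> = (\<Sum>\<eta>\<in>irreducible_characters G. \<Sum>x\<in>Y. \<Sum>y\<in>Y. of_nat (m \<eta>) * \<eta> (inv x \<otimes> y))"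
    by (rule sum.swap)
  also have "\<dots> = (\<Sum>\<eta>\<in>irreducible_characters G. of_nat (m \<eta>) * (\<Sum>x\<in>Y. \<Sum>y\<in>Y. \<eta> (inv x \<otimes> y)))"
    by (simp add: sum_distrib_left)
  also have "\<dots> = of_nat ((card Y)\<^sup>2) +
      (\<Sum>\<eta>\<in>irreducible_characters G - {\<chi>\<^sub>0}. of_nat (m \<eta>) * (\<Sum>x\<in>Y. \<Sum>y\<in>Y. \<eta> (inv x \<otimes> y)))"
    by (subst sum.remove[OF irr \<chi>\<^sub>0(1)]) (simp add: m0 triv)
  finally show ?thesis .
qed

text \<open>The function \<open>m\<close> is left arbitrary because the two directions of the
  theorem supply it differently: from the definition of a constituent, and from the decomposition of
  the permutation representation.\<close>

lemma (in transitive_action) transitive_subset_iff_characters: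
  assumes fin: "finite (carrier G)" "finite E" and Y: "Y \<subseteq> carrier G" "Y \<noteq> {}"
    and irr: "finite (irreducible_characters G)"
    and \<chi>\<^sub>0: "\<chi>\<^sub>0 \<in> irreducible_characters G" "\<And>g. g \<in> carrier G \<Longrightarrow> \<chi>\<^sub>0 g = 1"
    and m: "\<And>g. g \<in> carrier G \<Longrightarrow>
      permutation_character E \<phi> g = (\<Sum>\<eta>\<in>irreducible_characters G. of_nat (m \<eta>) * \<eta> g)"
    and E: "E \<noteq> {}"
  shows "transitive_subset E \<phi> Y \<longleftrightarrow>
    (\<forall>\<eta>\<in>irreducible_characters G - {\<chi>\<^sub>0}. m \<eta> > 0 \<longrightarrow> (\<Sum>x\<in>Y. \<Sum>y\<in>Y. \<eta> (inv x \<otimes> y)) = 0)"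
proof -
  interpret group G
    using group_hom group_hom.axioms(1) by auto
  have finY: "finite Y"
    by (rule finite_subset[OF Y(1) fin(1)])
  have "\<exists>r::real. r \<ge> 0 \<and> (\<Sum>x\<in>Y. \<Sum>y\<in>Y. \<eta> (inv x \<otimes> y)) = of_real r"
    if \<eta>: "\<eta> \<in> irreducible_characters G" for \<eta>
  proof -
    obtain d \<rho> where \<rho>: "is_representation G d \<rho>" "\<eta> = character_of G d \<rho>"
      using \<eta> by (auto simp: irreducible_characters_def irreducible_representation_def)
    show ?thesis
      unfolding \<rho>(2) by (rule sum_character_nonneg[OF fin(1) \<rho>(1) Y(1)]) blast
  qed
  then obtain r :: "('a \<Rightarrow> complex) \<Rightarrow> real" where r: "\<And>\<eta>. \<eta> \<in> irreducible_characters G \<Longrightarrow> r \<eta> \<ge> 0"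
    "\<And>\<eta>. \<eta> \<in> irreducible_characters G \<Longrightarrow> (\<Sum>x\<in>Y. \<Sum>y\<in>Y. \<eta> (inv x \<otimes> y)) = of_real (r \<eta>)"
    by metis
  let ?T = "\<Sum>a\<in>E. \<Sum>b\<in>E. (card {y\<in>Y. \<phi> y a = b})\<^sup>2"
  have "of_nat ?T = of_nat ((card Y)\<^sup>2) +
      (\<Sum>\<eta>\<in>irreducible_characters G - {\<chi>\<^sub>0}. of_nat (m \<eta>) * (\<Sum>x\<in>Y. \<Sum>y\<in>Y. \<eta> (inv x \<otimes> y)))"
    using sum_permutation_character[OF fin(2) Y(1) finY]
      sum_permutation_character_decomposition[OF fin Y(1) irr \<chi>\<^sub>0 m E] by simp
  also have "\<dots> = of_real (real ((card Y)\<^sup>2) + (\<Sum>\<eta>\<in>irreducible_characters G - {\<chi>\<^sub>0}. real (m \<eta>) * r \<eta>))"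
    by (simp add: r(2))
  \<comment> \<open>The identity is moved from the complex to the real numbers, where a sum of
    nonnegative terms vanishes only if each term does.\<close>
  finally have "real ?T = real ((card Y)\<^sup>2) + (\<Sum>\<eta>\<in>irreducible_characters G - {\<chi>\<^sub>0}. real (m \<eta>) * r \<eta>)"
    by (simp only: of_real_of_nat_eq[where 'a = complex, symmetric] of_real_eq_iff)
  then have "?T = (card Y)\<^sup>2 \<longleftrightarrow> (\<Sum>\<eta>\<in>irreducible_characters G - {\<chi>\<^sub>0}. real (m \<eta>) * r \<eta>) = 0"
    using of_nat_eq_iff[where ?'a = real, of ?T "(card Y)\<^sup>2"] by linarith
  also have "\<dots> \<longleftrightarrow> (\<forall>\<eta>\<in>irreducible_characters G - {\<chi>\<^sub>0}. real (m \<eta>) * r \<eta> = 0)"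
    using irr r(1) by (intro sum_nonneg_eq_0_iff) auto
  also have "\<dots> \<longleftrightarrow> (\<forall>\<eta>\<in>irreducible_characters G - {\<chi>\<^sub>0}. m \<eta> > 0 \<longrightarrow> (\<Sum>x\<in>Y. \<Sum>y\<in>Y. \<eta> (inv x \<otimes> y)) = 0)"
    by (intro ball_cong refl) (auto simp: r(2))
  finally show ?thesis
    using transitive_subset_iff[OF fin(2) E Y(1) finY Y(2)] by simp
qed

theorem theorem2p5:
  fixes G :: "('g, 'm) monoid_scheme"
    and \<Omega> :: "'w set"
    and \<phi> :: "'g \<Rightarrow> 'w \<Rightarrow> 'w"
    and \<chi> :: "nat \<Rightarrow> 'g \<Rightarrow> complex"
    and n :: nat
    and I :: "nat set"
    and Y :: "'g set"
  assumes "finite (carrier G)"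
    and "finite \<Omega>"
    and "transitive_action G \<Omega> \<phi>"
    and "bij_betw \<chi> {0..n} (irreducible_characters G)"
    and "\<forall>g\<in>carrier G. \<chi> 0 g = 1"
    and "I = {k \<in> {0..n}. irreducible_constituent G (permutation_character \<Omega> \<phi>) (\<chi> k)}"
    and "Y \<subseteq> carrier G"
    and "Y \<noteq> {}"
  shows "transitive_subset \<Omega> \<phi> Y \<longleftrightarrow> (\<forall>k \<in> I - {0}. dual_distribution G \<chi> Y k = 0)"
proof -
  interpret transitive_action G \<Omega> \<phi>
    by (rule assms(3))
  interpret group G
    using group_hom group_hom.axioms(1) by auto
  have irr: "finite (irreducible_characters G)"
    using assms(4) bij_betw_finite by blast
  have \<chi>: "\<chi> k \<in> irreducible_characters G" if "k \<le> n" for k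
    using assms(4) that by (auto simp: bij_betw_def)
  have \<chi>_surj: "\<exists>k\<le>n. k \<noteq> 0 \<and> \<eta> = \<chi> k" if "\<eta> \<in> irreducible_characters G - {\<chi> 0}" for \<eta>
  proof -
    have "\<eta> \<in> \<chi> ` {0..n}"
      using that bij_betw_imp_surj_on[OF assms(4)] by simp
    then obtain k where "k \<le> n" "\<eta> = \<chi> k"
      by auto
    then show ?thesis
      using that by (intro exI[of _ k]) auto
  qed
  have \<chi>_inj: "\<chi> k \<noteq> \<chi> 0" if "k \<le> n" "k \<noteq> 0" for k
    using inj_onD[OF bij_betw_imp_inj_on[OF assms(4)], of k 0] that by auto
  \<comment> \<open>The factor in front of the double sum is the degree divided by
    \<open>card Y\<close>, and both are nonzero.\<close>
  have dual: "dual_distribution G \<chi> Y k = 0 \<longleftrightarrow> (\<Sum>x\<in>Y. \<Sum>y\<in>Y. \<chi> k (inv\<^bsub>G\<^esub> x \<otimes>\<^bsub>G\<^esub> y)) = 0" if "k \<le> n" for k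
    using irreducible_character_one[OF \<chi>[OF that]] finite_subset[OF assms(7,1)] assms(8)
    by (simp add: dual_distribution_def)
  show ?thesis
  \<comment> \<open>A transitive action on the empty set is possible. Then every \<open>Y\<close> is
    transitive vacuously, and the permutation character is 0 and has no constituents, so
    \<open>I\<close> is empty.\<close>
  proof (cases "\<Omega> = {}")
    case True
    have "\<not> irreducible_constituent G (permutation_character \<Omega> \<phi>) \<eta>" for \<eta>
    proof
      assume "irreducible_constituent G (permutation_character \<Omega> \<phi>) \<eta>"
      then obtain m :: "('g \<Rightarrow> complex) \<Rightarrow> nat" where \<eta>: "\<eta> \<in> irreducible_characters G" "m \<eta> > 0"
        and m: "(\<Sum>\<eta>\<in>irreducible_characters G. of_nat (m \<eta>) * \<eta> \<one>\<^bsub>G\<^esub>) = 0"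
        using True by (auto simp: irreducible_constituent_def permutation_character_def)
      \<comment> \<open>At the identity the zero character becomes a sum of multiplicities times
        positive integer degrees, so all multiplicities would be 0.\<close>
      have deg: "\<exists>d::nat. d > 0 \<and> \<eta> \<one>\<^bsub>G\<^esub> = of_nat d" if "\<eta> \<in> irreducible_characters G" for \<eta>
        using that
        by (auto simp: irreducible_characters_def character_of_def irreducible_representation_def representation_one)
      then obtain d :: "('g \<Rightarrow> complex) \<Rightarrow> nat"
        where d: "\<And>\<eta>. \<eta> \<in> irreducible_characters G \<Longrightarrow> d \<eta> > 0 \<and> \<eta> \<one>\<^bsub>G\<^esub> = of_nat (d \<eta>)"
        by metis
      have "of_nat (\<Sum>\<eta>\<in>irreducible_characters G. m \<eta> * d \<eta>) = (0 :: complex)"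
        using m d by simp
      then show False
        using \<eta> d[OF \<eta>(1)] irr by (simp only: of_nat_eq_0_iff) auto
    qed
    then show ?thesis
      using True assms(6) by (auto simp: transitive_subset_def)
  next
    case False
    note crit = transitive_subset_iff_characters[OF assms(1,2,7,8) irr \<chi>[OF le0] _ _ False]
    show ?thesis
    proof
      assume trans: "transitive_subset \<Omega> \<phi> Y"
      show "\<forall>k\<in>I - {0}. dual_distribution G \<chi> Y k = 0"
      proof
        fix k assume k: "k \<in> I - {0}"
        \<comment> \<open>This \<open>m\<close> depends on \<open>k\<close>: it witnesses that
          \<open>\<chi> k\<close> is a constituent.\<close>
        then obtain m :: "('g \<Rightarrow> complex) \<Rightarrow> nat" where "m (\<chi> k) > 0"
          and m: "\<And>g. g \<in> carrier G \<Longrightarrow>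
            permutation_character \<Omega> \<phi> g = (\<Sum>\<eta>\<in>irreducible_characters G. of_nat (m \<eta>) * \<eta> g)"
          using assms(6) by (auto simp: irreducible_constituent_def)
        moreover have "k \<le> n" "\<chi> k \<in> irreducible_characters G - {\<chi> 0}"
          using k assms(6) \<chi> \<chi>_inj by auto
        ultimately show "dual_distribution G \<chi> Y k = 0"
          using crit[of m] assms(5) trans by (simp add: dual)
      qed
    next
      assume *: "\<forall>k\<in>I - {0}. dual_distribution G \<chi> Y k = 0"
      \<comment> \<open>Here one \<open>m\<close> must serve all characters at once. It comes from
        decomposing the permutation representation, and each \<open>\<eta>\<close> with
        \<open>m \<eta> > 0\<close> is a constituent by virtue of this same
        \<open>m\<close>.\<close>
      obtain d \<rho> where \<rho>: "is_representation G d \<rho>"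
        "\<And>g. g \<in> carrier G \<Longrightarrow> character_of G d \<rho> g = permutation_character \<Omega> \<phi> g"
        using permutation_character_afforded[OF assms(2)] by blast
      obtain m :: "('g \<Rightarrow> complex) \<Rightarrow> nat" where m: "\<And>g. g \<in> carrier G \<Longrightarrow>
          permutation_character \<Omega> \<phi> g = (\<Sum>\<eta>\<in>irreducible_characters G. of_nat (m \<eta>) * \<eta> g)"
        using character_decomposition[OF irr \<rho>(1)] \<rho>(2) by auto
      have "(\<Sum>x\<in>Y. \<Sum>y\<in>Y. \<eta> (inv\<^bsub>G\<^esub> x \<otimes>\<^bsub>G\<^esub> y)) = 0"
        if \<eta>: "\<eta> \<in> irreducible_characters G - {\<chi> 0}" "m \<eta> > 0" for \<eta>
      proof -
        obtain k where k: "k \<le> n" "k \<noteq> 0" "\<eta> = \<chi> k"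
          using \<chi>_surj[OF \<eta>(1)] by blast
        have "irreducible_constituent G (permutation_character \<Omega> \<phi>) \<eta>"
          using \<eta> m unfolding irreducible_constituent_def by blast
        then have "k \<in> I - {0}"
          using k assms(6) by simp
        with * have "dual_distribution G \<chi> Y k = 0" ..
        then show ?thesis
          using dual[OF k(1)] k(3) by simp
      qed
      then show "transitive_subset \<Omega> \<phi> Y"
        using crit[of m] assms(5) m by simp
    qed
  qed
qed

end
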